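(* Let $p\ge2$ and $w=2p-1$. Consider the semi-discrete scheme, for all grid indices $\bm i$, $$\frac{\mathrm d}{\mathrm dt}(J_{\bm i}\bm U_{\bm i})=-\sum_{k=1}^3\frac{1}{\Delta\xi_k}\Big((\widehat{\mathcal F}_k)^{w}_{\bm i,k,+\frac12}-(\widehat{\mathcal F}_k)^{w}_{\bm i,k,-\frac12}\Big)-\Phi'(\bm V_{\bm i})^{\mathrm T}\sum_{k=1}^3\frac{1}{\Delta\xi_k}\Big((\widetilde{\mathcal B}_k)^{2p}_{\bm i,k,+\frac12}-(\widetilde{\mathcal B}_k)^{2p}_{\bm i,k,-\frac12}\Big),$$ $$\frac{\mathrm d}{\mathrm dt}J_{\bm i}=-\sum_{k=1}^3\frac{1}{\Delta\xi_k}\Big((\widetilde{M}_{k,t})^{2p}_{\bm i,k,+\frac12}-(\widetilde{M}_{k,t})^{2p}_{\bm i,k,-\frac12}\Big),$$ where $$(\widehat{\mathcal F}_k)^{w}_{\bm i,k,+\frac12}=(\widetilde{\mathcal F}_k)^{2p}_{\bm i,k,+\frac12}-\tfrac12\bm D_{\bm i,k,+\frac12}\bm Y_{\bm i,k,+\frac12}\langle\!\langle\widetilde{\bm V}\rangle\!\rangle^{\rm WENO}_{\bm i,k,+\frac12},$$ with all objects defined in the context. Then the scheme is entropy stable: its solutions satisfy, at every $\bm i$, $$\frac{\mathrm d}{\mathrm dt}\big(J_{\bm i}\,\eta(\bm U_{\bm i}(t))\big)+\sum_{k=1}^3\frac1{\Delta\xi_k}\Big((\widehat{\mathfrak q}_k)^{w}_{\bm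 i,k,+\frac12}-(\widehat{\mathfrak q}_k)^{w}_{\bm i,k,-\frac12}\Big)\le0,$$ with the numerical entropy fluxes, consistent with $\mathfrak q_k=J\partial_t\xi_k\,\eta+\sum_jJ\partial_{x_j}\xi_k\,q_j$, $$(\widehat{\mathfrak q}_k)^{w}_{\bm i,k,+\frac12}=(\widetilde{\mathfrak q}_k)^{2p}_{\bm i,k,+\frac12}-\tfrac12\widehat\lambda_{\bm i,k,+\frac12}\{\!\!\{\widetilde{\bm V}\}\!\!\}^{\mathrm T}_{\bm i,k,+\frac12}\bm Y_{\bm i,k,+\frac12}\langle\!\langle\widetilde{\bm V}\rangle\!\rangle^{\rm WENO}_{\bm i,k,+\frac12}.$$
   Context: **Physical system (3D special relativistic MHD, speed of light 1).** States have rest-mass density $\rho>0$, pressure $p_{\rm gas}>0$, velocity $\bm v\in\mathbb R^3$ with $|\bm v|<1$, magnetic field $\bm B\in\mathbb R^3$. Put $W=(1-|\bm v|^2)^{-1/2}$, adiabatic index $\Gamma\in(1,2]$, $h=1+\frac{\Gamma}{\Gamma-1}\frac{p_{\rm gas}}{\rho}$, $|b|^2=|\bm B|^2/W^2+(\bm v\cdot\bm B)^2$, $p_{\rm tot}=p_{\rm gas}+\frac12|b|^2$. The conservative vector is $\bm U=(D,\bm m,E,\bm B)^{\mathrm T}\in\mathbb R^8$, with $D=\rho W$, $\bm m=(\rho hW^2+|\bm B|^2)\bm v-(\bm v\cdot\bm B)\bm B$, $E=DhW-p_{\rm tot}+|\bm B|^2$; primitive variables are functions of $\bm U$. For $k=1,2,3$,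 $$\bm F_k=\big(Dv_k,\ \bm m v_k-B_k(\bm B/W^2+(\bm v\cdot\bm B)\bm v)+p_{\rm tot}\bm e_k,\ m_k,\ v_k\bm B-B_k\bm v\big)^{\mathrm T},$$ $\bm e_k$ the $k$-th unit vector. **Entropy quantities.** $s=\ln(p_{\rm gas}/\rho^\Gamma)$, $\eta(\bm U)=-\frac{\rho Ws}{\Gamma-1}$ (strictly convex in $\bm U$), $q_k=\eta v_k$, $\bm V=\eta'(\bm U)^{\mathrm T}=\Big(\frac{\Gamma-s}{\Gamma-1}+\frac{\rho}{p_{\rm gas}},\ \frac{\rho W\bm v^{\mathrm T}}{p_{\rm gas}},\ -\frac{\rho W}{p_{\rm gas}},\ \frac{\rho(\bm B+W^2\bm v(\bm v\cdot\bm B))}{p_{\rm gas}W}\Big)^{\mathrm T}$. $\Phi=\frac{\rho W(\bm v\cdot\bm B)}{p_{\rm gas}}$, viewed as a function of $\bm V$, is homogeneous of degree one with $\Phi'(\bm V)=(0,\ \bm B/W^2+\bm v(\bm v\cdot\bm B),\ \bm v\cdot\bm B,\ \bm v)$, so $\Phi=\Phi'(\bm V)\bm V$. Potentials: $\phi=\bm V^{\mathrm T}\bm U-\eta$, $\psi_k=\bm V^{\mathrm T}\bm F_k+\Phi B_k-q_k$. **Grid notation.** The scheme discretizes, under a moving coordinate map $t=\tau$, $\bm x=\bm x(\tau,\bm\xi)$ with Jacobian determinant $J$, the system $\partial_\tau(J\bm U)+\sum_k\partial_{\xi_k}\big(J\partial_t\xi_k\bm U+\sum_jJ\partial_{x_j}\xi_k\bm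 F_j\big)=-\Phi'(\bm V)^{\mathrm T}\sum_k\partial_{\xi_k}\big(\sum_jJ\partial_{x_j}\xi_kB_j\big)$. Uniform Cartesian grid in $\bm\xi$ with steps $\Delta\xi_k$, indices $\bm i=(i_1,i_2,i_3)$ (boundaries are ignored). The subscript $\bm i,k,n$ means $i_k$ is increased by $n$; half-integer shifts denote interfaces, and the value at $\bm i,k,-\frac12$ is the one at $\bm i',k,+\frac12$ with $\bm i'=(\bm i,k,-1)$. $\bm U_{\bm i}=(J\bm U)_{\bm i}/J_{\bm i}$, with $J_{\bm i}>0$, is assumed admissible. The grid points $\bm x_{\bm i}(t)$ move with velocity $\dot{\bm x}_{\bm i}$. **Coefficients.** $\alpha_{p,1},\dots,\alpha_{p,p}$ satisfy $\sum_{n=1}^pn\alpha_{p,n}=1$ and $\sum_{n=1}^pn^{2s-1}\alpha_{p,n}=0$ for $s=2,\dots,p$. **Discrete metrics.** Write $M_{k,x_j}$ for $J\partial_{x_j}\xi_k$ and $M_{k,t}$ for $J\partial_t\xi_k$. With $\delta_k[a]_{\bm i}=\frac12\sum_{n=1}^p\alpha_{p,n}(a_{\bm i,k,+n}-a_{\bm i,k,-n})$, for $(k,k',k'')$ and $(j,j',j'')$ cyclic permutations of $(1,2,3)$, $$(M_{k,x_j})_{\bm i}=\frac{1}{\Delta\xi_{k'}\Delta\xi_{k''}}\Big(\delta_{k''}\big[\delta_{k'}[x_{j'}]\,x_{j''}\big]-\delta_{k'}\big[\delta_{k''}[x_{j'}]\,x_{j''}\big]\Big)_{\bm i},\quad (M_{k,t})_{\bm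 i}=-\sum_{j=1}^3(\dot x_j)_{\bm i}(M_{k,x_j})_{\bm i}.$$ **Two-point fluxes.** $\widetilde{\bm U}(\bm U_l,\bm U_r)$ and $\widetilde{\bm F}_j(\bm U_l,\bm U_r)$ are smooth, symmetric, consistent ($\widetilde{\bm U}(\bm U,\bm U)=\bm U$, $\widetilde{\bm F}_j(\bm U,\bm U)=\bm F_j(\bm U)$) and satisfy $(\bm V_r-\bm V_l)^{\mathrm T}\widetilde{\bm U}=\phi_r-\phi_l$, $(\bm V_r-\bm V_l)^{\mathrm T}\widetilde{\bm F}_j=(\psi_j)_r-(\psi_j)_l-\frac12\big((B_j)_l+(B_j)_r\big)(\Phi_r-\Phi_l)$. For grid points $l,r$: $$\widetilde{\mathcal F}_k(l;r)=\tfrac12\big((M_{k,t})_l+(M_{k,t})_r\big)\widetilde{\bm U}(\bm U_l,\bm U_r)+\sum_{j=1}^3\tfrac12\big((M_{k,x_j})_l+(M_{k,x_j})_r\big)\widetilde{\bm F}_j(\bm U_l,\bm U_r),$$ $$\widetilde{\mathcal B}_k(l;r)=\sum_{j=1}^3\tfrac14\big((M_{k,x_j})_l+(M_{k,x_j})_r\big)\big((B_j)_l+(B_j)_r\big),\qquad \widetilde M_{k,t}(l;r)=\tfrac12\big((M_{k,t})_l+(M_{k,t})_r\big),$$ $$\begin{aligned}\widetilde{\mathfrak q}_k(l;r)=&\ \tfrac12(\bm V_l+\bm V_r)^{\mathrm T}\widetilde{\mathcal F}_k(l;r)-\tfrac14\big((M_{k,t})_l+(M_{k,t})_r\big)(\phi_l+\phi_r)-\sum_{j=1}^3\tfrac14\big((M_{k,x_j})_l+(M_{k,x_j})_r\big)\big((\psi_j)_l+(\psi_j)_r\big)\\&+\sum_{j=1}^3\tfrac18\big((M_{k,x_j})_l+(M_{k,x_j})_r\big)\big((B_j)_l+(B_j)_r\big)(\Phi_l+\Phi_r).\end{aligned}$$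 **$2p$th-order fluxes.** For $\widetilde G\in\{\widetilde{\mathcal F}_k,\widetilde{\mathcal B}_k,\widetilde M_{k,t},\widetilde{\mathfrak q}_k\}$: $\displaystyle(\widetilde G)^{2p}_{\bm i,k,+\frac12}=\sum_{n=1}^p\alpha_{p,n}\sum_{s=0}^{n-1}\widetilde G(\bm i,k,-s\,;\ \bm i,k,-s+n).$ **Dissipation.** $\bm D=\widehat\lambda\,\bm T^{-1}\bm R(\bm T\bm U)$ evaluated at the interface (with some interface values of $\bm U$ and the metrics). $\bm T=\mathrm{diag}\{1,\bm T_0,1,\bm T_0\}$ with the rotation matrix $$\bm T_0=\begin{pmatrix}\cos\varphi\cos\theta&\cos\varphi\sin\theta&\sin\varphi\\-\sin\theta&\cos\theta&0\\-\sin\varphi\cos\theta&-\sin\varphi\sin\theta&\cos\varphi\end{pmatrix},$$ $\theta=\arctan(M_{k,x_2}/M_{k,x_1})$, $\varphi=\arctan\big(M_{k,x_3}/\sqrt{M_{k,x_1}^2+M_{k,x_2}^2}\big)$. $\bm R(\bm U)$ is a matrix of scaled eigenvectors: $\partial\bm U/\partial\bm V=\bm R\bm R^{\mathrm T}$ and $\partial\bm F_1/\partial\bm U+\Phi'(\bm V)^{\mathrm T}\partial B_1/\partial\bm U=\bm R\bm\Lambda\bm R^{-1}$, $\bm\Lambda=\mathrm{diag}\{\lambda_1,\dots,\lambda_8\}$. $\widehat\lambda=\max_m|M_{k,t}+L_k\lambda_m(\bm T\bm U)|$, $L_k=\big(\sum_jM_{k,x_j}^2\big)^{1/2}$. For fixed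 interface $\bm i,k,+\frac12$, the scaled entropy variables at grid points along direction $k$ are $\widetilde{\bm V}=\bm R^{\mathrm T}_{\bm i,k,+\frac12}(\bm T\bm U)\,\bm T_{\bm i,k,+\frac12}\bm V$ (matrices frozen at that interface). $\langle\!\langle\widetilde{\bm V}\rangle\!\rangle^{\rm WENO}_{\bm i,k,+\frac12}$ is the right minus the left limit value at the interface produced componentwise by the $(2p-1)$th-order Jiang–Shu WENO reconstruction of $\widetilde{\bm V}$ in direction $k$. $[\![\widetilde{\bm V}]\!]_{\bm i,k,+\frac12}=\widetilde{\bm V}_{\bm i,k,+1}-\widetilde{\bm V}_{\bm i}$, $\{\!\!\{\widetilde{\bm V}\}\!\!\}_{\bm i,k,+\frac12}=\frac12(\widetilde{\bm V}_{\bm i,k,+1}+\widetilde{\bm V}_{\bm i})$. $\bm Y_{\bm i,k,+\frac12}$ is diagonal; its $l$-th entry is $1$ if the $l$-th components of $\langle\!\langle\widetilde{\bm V}\rangle\!\rangle^{\rm WENO}_{\bm i,k,+\frac12}$ and $[\![\widetilde{\bm V}]\!]_{\bm i,k,+\frac12}$ have the same sign, and $0$ otherwise. Consistency of a numerical entropy flux means it reduces to $\mathfrak q_k$ when all state and metric arguments coincide. *)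

theory Defs
  imports "HOL-Analysis.Analysis" "HOL-Computational_Algebra.Polynomial"
begin

type_synonym vec3 = "real ^ 3"
type_synonym vec8 = "real ^ 8"
type_synonym grid = "int ^ 3"

section \<open>States, fluxes and entropy quantities\<close>

type_synonym prims = "real \<times> vec3 \<times> real \<times> vec3"  \<comment> \<open>(density, velocity, gas pressure, magnetic field)\<close>

definition pack8 :: "real \<Rightarrow> vec3 \<Rightarrow> real \<Rightarrow> vec3 \<Rightarrow> vec8" where
  "pack8 a m e b = vector [a, m $ 1, m $ 2, m $ 3, e, b $ 1, b $ 2, b $ 3]"

definition lorentz :: "vec3 \<Rightarrow> real" where
  "lorentz v = 1 / sqrt (1 - (norm v)\<^sup>2)"

definition enthalpy :: "real \<Rightarrow> real \<Rightarrow> real \<Rightarrow> real" where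
  "enthalpy \<Gamma> \<rho> p = 1 + \<Gamma> / (\<Gamma> - 1) * (p / \<rho>)"

definition p_total :: "real \<Rightarrow> vec3 \<Rightarrow> vec3 \<Rightarrow> real" where
  "p_total p v B = p + ((norm B)\<^sup>2 / (lorentz v)\<^sup>2 + (v \<bullet> B)\<^sup>2) / 2"

definition prim_states :: "prims set" where
  "prim_states = {(\<rho>, v, p, B). \<rho> > 0 \<and> norm v < 1 \<and> p > 0}"

definition conservative :: "real \<Rightarrow> prims \<Rightarrow> vec8" where
  "conservative \<Gamma> = (\<lambda>(\<rho>, v, p, B).
     let W = lorentz v; h = enthalpy \<Gamma> \<rho> p; D = \<rho> * W in
     pack8 D
       ((\<rho> * h * W\<^sup>2 + (norm B)\<^sup>2) *\<^sub>R v - (v \<bullet> B) *\<^sub>R B)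
       (D * h * W - p_total p v B + (norm B)\<^sup>2)
       B)"

definition admissible :: "real \<Rightarrow> vec8 set" where
  "admissible \<Gamma> = conservative \<Gamma> ` prim_states"

definition prim :: "real \<Rightarrow> vec8 \<Rightarrow> prims" where
  "prim \<Gamma> = inv_into prim_states (conservative \<Gamma>)"

definition dens :: "real \<Rightarrow> vec8 \<Rightarrow> real" where "dens \<Gamma> U = fst (prim \<Gamma> U)"
definition vel :: "real \<Rightarrow> vec8 \<Rightarrow> vec3" where "vel \<Gamma> U = fst (snd (prim \<Gamma> U))"
definition pgas :: "real \<Rightarrow> vec8 \<Rightarrow> real" where "pgas \<Gamma> U = fst (snd (snd (prim \<Gamma> U)))"

definition momentum :: "vec8 \<Rightarrow> vec3" where "momentum U = vector [U $ 2, U $ 3, U $ 4]"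
definition mag :: "vec8 \<Rightarrow> vec3" where "mag U = vector [U $ 6, U $ 7, U $ 8]"

definition flux :: "real \<Rightarrow> 3 \<Rightarrow> vec8 \<Rightarrow> vec8" where
  "flux \<Gamma> k U =
     (let v = vel \<Gamma> U; B = mag U; m = momentum U; W = lorentz v in
      pack8 (U $ 1 * v $ k)
        ((v $ k) *\<^sub>R m - (B $ k) *\<^sub>R ((1 / W\<^sup>2) *\<^sub>R B + (v \<bullet> B) *\<^sub>R v)
           + p_total (pgas \<Gamma> U) v B *\<^sub>R axis k 1)
        (m $ k)
        ((v $ k) *\<^sub>R B - (B $ k) *\<^sub>R v))"

definition spec_entropy :: "real \<Rightarrow> vec8 \<Rightarrow> real" where
  "spec_entropy \<Gamma> U = ln (pgas \<Gamma> U / dens \<Gamma> U powr \<Gamma>)"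

definition eta :: "real \<Rightarrow> vec8 \<Rightarrow> real" where
  "eta \<Gamma> U = - (dens \<Gamma> U * lorentz (vel \<Gamma> U) * spec_entropy \<Gamma> U) / (\<Gamma> - 1)"

definition entropy_flux :: "real \<Rightarrow> 3 \<Rightarrow> vec8 \<Rightarrow> real" where
  "entropy_flux \<Gamma> k U = eta \<Gamma> U * vel \<Gamma> U $ k"

definition entropy_vars :: "real \<Rightarrow> vec8 \<Rightarrow> vec8" where
  "entropy_vars \<Gamma> U =
     (let \<rho> = dens \<Gamma> U; v = vel \<Gamma> U; p = pgas \<Gamma> U; B = mag U; W = lorentz v in
      pack8 ((\<Gamma> - spec_entropy \<Gamma> U) / (\<Gamma> - 1) + \<rho> / p)
        ((\<rho> * W / p) *\<^sub>R v)
        (- (\<rho> * W / p))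
        ((\<rho> / (p * W)) *\<^sub>R (B + (W\<^sup>2 * (v \<bullet> B)) *\<^sub>R v)))"

definition Phi :: "real \<Rightarrow> vec8 \<Rightarrow> real" where
  "Phi \<Gamma> U = dens \<Gamma> U * lorentz (vel \<Gamma> U) * (vel \<Gamma> U \<bullet> mag U) / pgas \<Gamma> U"

text \<open>The gradient of \<open>\<Phi>\<close> with respect to the entropy variables, expressed as a function of
  the conservative state.\<close>

definition dPhi :: "real \<Rightarrow> vec8 \<Rightarrow> vec8" where
  "dPhi \<Gamma> U =
     (let v = vel \<Gamma> U; B = mag U; W = lorentz v in
      pack8 0 ((1 / W\<^sup>2) *\<^sub>R B + (v \<bullet> B) *\<^sub>R v) (v \<bullet> B) v)"

definition pot_phi :: "real \<Rightarrow> vec8 \<Rightarrow> real" where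
  "pot_phi \<Gamma> U = entropy_vars \<Gamma> U \<bullet> U - eta \<Gamma> U"

definition pot_psi :: "real \<Rightarrow> 3 \<Rightarrow> vec8 \<Rightarrow> real" where
  "pot_psi \<Gamma> k U = entropy_vars \<Gamma> U \<bullet> flux \<Gamma> k U + Phi \<Gamma> U * mag U $ k - entropy_flux \<Gamma> k U"

section \<open>Entropy conservative two-point fluxes\<close>

text \<open>Iterated continuous differentiability on an open set of a finite-dimensional space, phrased
  through directional derivatives.\<close>

primrec Ck_on :: "nat \<Rightarrow> ('a::real_normed_vector \<Rightarrow> 'b::real_normed_vector) \<Rightarrow> 'a set \<Rightarrow> bool" where
  "Ck_on 0 f S = continuous_on S f"
| "Ck_on (Suc n) f S =
     (\<exists>f'. (\<forall>x\<in>S. (f has_derivative f' x) (at x)) \<and> (\<forall>v. Ck_on n (\<lambda>x. f' x v) S))"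

definition smooth_on :: "('a::real_normed_vector \<Rightarrow> 'b::real_normed_vector) \<Rightarrow> 'a set \<Rightarrow> bool" where
  "smooth_on f S \<longleftrightarrow> (\<forall>n. Ck_on n f S)"

definition smooth_symmetric_consistent ::
    "real \<Rightarrow> (vec8 \<Rightarrow> vec8 \<Rightarrow> vec8) \<Rightarrow> (vec8 \<Rightarrow> vec8) \<Rightarrow> bool" where
  "smooth_symmetric_consistent \<Gamma> G g \<longleftrightarrow>
     smooth_on (\<lambda>(a, b). G a b) (admissible \<Gamma> \<times> admissible \<Gamma>) \<and>
     (\<forall>a\<in>admissible \<Gamma>. \<forall>b\<in>admissible \<Gamma>. G a b = G b a) \<and>
     (\<forall>a\<in>admissible \<Gamma>. G a a = g a)"

definition two_point_fluxes ::
    "real \<Rightarrow> (vec8 \<Rightarrow> vec8 \<Rightarrow> vec8) \<Rightarrow> (3 \<Rightarrow> vec8 \<Rightarrow> vec8 \<Rightarrow> vec8) \<Rightarrow> bool" where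
  "two_point_fluxes \<Gamma> Ut Ft \<longleftrightarrow>
     smooth_symmetric_consistent \<Gamma> Ut (\<lambda>u. u) \<and>
     (\<forall>j. smooth_symmetric_consistent \<Gamma> (Ft j) (flux \<Gamma> j)) \<and>
     (\<forall>l\<in>admissible \<Gamma>. \<forall>r\<in>admissible \<Gamma>.
        (entropy_vars \<Gamma> r - entropy_vars \<Gamma> l) \<bullet> Ut l r = pot_phi \<Gamma> r - pot_phi \<Gamma> l \<and>
        (\<forall>j. (entropy_vars \<Gamma> r - entropy_vars \<Gamma> l) \<bullet> Ft j l r =
              pot_psi \<Gamma> j r - pot_psi \<Gamma> j l
              - 1/2 * (mag l $ j + mag r $ j) * (Phi \<Gamma> r - Phi \<Gamma> l)))"

section \<open>Discrete metrics and high-order fluxes\<close>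

text \<open>A grid index is a vector in \<open>int ^ 3\<close>; \<open>i + axis k n\<close> is the index \<open>i\<close> shifted by \<open>n\<close> in direction
  \<open>k\<close>. Quantities at the interface between \<open>i\<close> and \<open>i + axis k 1\<close> are indexed by \<open>(i, k)\<close>. Addition
  on the index type \<open>3\<close> is modulo 3, so \<open>(k, k + 1, k + 2)\<close> runs through the cyclic permutations.
  In a metric field \<open>Mx\<close>, the value \<open>Mx i k $ j\<close> is that of \<open>J \<partial>\<xi>\<^sub>k/\<partial>x\<^sub>j\<close> at grid point \<open>i\<close>, and
  \<open>Mt i k\<close> is that of \<open>J \<partial>\<xi>\<^sub>k/\<partial>t\<close>.\<close>

definition central_coeffs :: "nat \<Rightarrow> (nat \<Rightarrow> real) \<Rightarrow> bool" where
  "central_coeffs p \<alpha> \<longleftrightarrow>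
     (\<Sum>n=1..p. real n * \<alpha> n) = 1 \<and>
     (\<forall>s\<in>{2..p}. (\<Sum>n=1..p. real n ^ (2 * s - 1) * \<alpha> n) = 0)"

definition central_diff :: "nat \<Rightarrow> (nat \<Rightarrow> real) \<Rightarrow> 3 \<Rightarrow> (grid \<Rightarrow> real) \<Rightarrow> grid \<Rightarrow> real" where
  "central_diff p \<alpha> k a i =
     1/2 * (\<Sum>n=1..p. \<alpha> n * (a (i + axis k (int n)) - a (i - axis k (int n))))"

definition metric_x :: "nat \<Rightarrow> (nat \<Rightarrow> real) \<Rightarrow> vec3 \<Rightarrow> (grid \<Rightarrow> vec3) \<Rightarrow> grid \<Rightarrow> 3 \<Rightarrow> vec3" where
  "metric_x p \<alpha> \<Delta> x i k = (\<chi> j.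
     1 / (\<Delta> $ (k + 1) * \<Delta> $ (k + 2)) *
     (central_diff p \<alpha> (k + 2)
        (\<lambda>i'. central_diff p \<alpha> (k + 1) (\<lambda>l. x l $ (j + 1)) i' * x i' $ (j + 2)) i
      - central_diff p \<alpha> (k + 1)
        (\<lambda>i'. central_diff p \<alpha> (k + 2) (\<lambda>l. x l $ (j + 1)) i' * x i' $ (j + 2)) i))"

definition metric_t ::
    "nat \<Rightarrow> (nat \<Rightarrow> real) \<Rightarrow> vec3 \<Rightarrow> (grid \<Rightarrow> vec3) \<Rightarrow> (grid \<Rightarrow> vec3) \<Rightarrow> grid \<Rightarrow> 3 \<Rightarrow> real" where
  "metric_t p \<alpha> \<Delta> x xdot i k = - (\<Sum>j\<in>UNIV. xdot i $ j * metric_x p \<alpha> \<Delta> x i k $ j)"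

definition flux2 ::
    "(vec8 \<Rightarrow> vec8 \<Rightarrow> vec8) \<Rightarrow> (3 \<Rightarrow> vec8 \<Rightarrow> vec8 \<Rightarrow> vec8) \<Rightarrow> (grid \<Rightarrow> 3 \<Rightarrow> real) \<Rightarrow> (grid \<Rightarrow> 3 \<Rightarrow> vec3) \<Rightarrow>
     (grid \<Rightarrow> vec8) \<Rightarrow> 3 \<Rightarrow> grid \<Rightarrow> grid \<Rightarrow> vec8" where
  "flux2 Ut Ft Mt Mx U k l r =
     (1/2 * (Mt l k + Mt r k)) *\<^sub>R Ut (U l) (U r)
     + (\<Sum>j\<in>UNIV. (1/2 * (Mx l k $ j + Mx r k $ j)) *\<^sub>R Ft j (U l) (U r))"

definition mag2 :: "(grid \<Rightarrow> 3 \<Rightarrow> vec3) \<Rightarrow> (grid \<Rightarrow> vec8) \<Rightarrow> 3 \<Rightarrow> grid \<Rightarrow> grid \<Rightarrow> real" where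
  "mag2 Mx U k l r =
     (\<Sum>j\<in>UNIV. 1/4 * (Mx l k $ j + Mx r k $ j) * (mag (U l) $ j + mag (U r) $ j))"

definition metric_t2 :: "(grid \<Rightarrow> 3 \<Rightarrow> real) \<Rightarrow> 3 \<Rightarrow> grid \<Rightarrow> grid \<Rightarrow> real" where
  "metric_t2 Mt k l r = 1/2 * (Mt l k + Mt r k)"

definition entropy_flux2 ::
    "real \<Rightarrow> (vec8 \<Rightarrow> vec8 \<Rightarrow> vec8) \<Rightarrow> (3 \<Rightarrow> vec8 \<Rightarrow> vec8 \<Rightarrow> vec8) \<Rightarrow> (grid \<Rightarrow> 3 \<Rightarrow> real) \<Rightarrow>
     (grid \<Rightarrow> 3 \<Rightarrow> vec3) \<Rightarrow> (grid \<Rightarrow> vec8) \<Rightarrow> 3 \<Rightarrow> grid \<Rightarrow> grid \<Rightarrow> real" where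
  "entropy_flux2 \<Gamma> Ut Ft Mt Mx U k l r =
     ((1/2) *\<^sub>R (entropy_vars \<Gamma> (U l) + entropy_vars \<Gamma> (U r))) \<bullet> flux2 Ut Ft Mt Mx U k l r
     - 1/4 * (Mt l k + Mt r k) * (pot_phi \<Gamma> (U l) + pot_phi \<Gamma> (U r))
     - (\<Sum>j\<in>UNIV. 1/4 * (Mx l k $ j + Mx r k $ j) * (pot_psi \<Gamma> j (U l) + pot_psi \<Gamma> j (U r)))
     + (\<Sum>j\<in>UNIV. 1/8 * (Mx l k $ j + Mx r k $ j) * (mag (U l) $ j + mag (U r) $ j)
                    * (Phi \<Gamma> (U l) + Phi \<Gamma> (U r)))"

definition high_order ::
    "nat \<Rightarrow> (nat \<Rightarrow> real) \<Rightarrow> (3 \<Rightarrow> grid \<Rightarrow> grid \<Rightarrow> 'a::real_vector) \<Rightarrow> grid \<Rightarrow> 3 \<Rightarrow> 'a" where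
  "high_order p \<alpha> G i k =
     (\<Sum>n=1..p. \<alpha> n *\<^sub>R
        (\<Sum>s<n. G k (i + axis k (- int s)) (i + axis k (- int s + int n))))"

section \<open>WENO reconstruction\<close>

text \<open>Data \<open>v j\<close> are treated as averages over the unit cells centred at the integers \<open>j\<close>.
  \<open>recon_poly a r v\<close> is the polynomial of degree less than \<open>r\<close> with these averages over the \<open>r\<close>
  cells starting at \<open>a\<close>; the interface of interest is at \<open>1/2\<close>, between cells 0 and 1.\<close>

definition recon_poly :: "int \<Rightarrow> nat \<Rightarrow> (int \<Rightarrow> real) \<Rightarrow> real poly" where
  "recon_poly a r v = (THE q. degree q < r \<and>
     (\<forall>j\<in>{a..<a + int r}. integral {real_of_int j - 1/2 .. real_of_int j + 1/2} (poly q) = v j))"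

text \<open>The optimal linear weight of the candidate stencil shifted by \<open>m\<close> cells to the left, i.e. the
  weight for which the combined value at the interface is the one of the degree \<open>2p - 2\<close>
  reconstruction: \<open>2/3, 1/3\<close> for \<open>p = 2\<close> and \<open>3/10, 6/10, 1/10\<close> for \<open>p = 3\<close>.\<close>

definition weno_linear :: "nat \<Rightarrow> nat \<Rightarrow> real" where
  "weno_linear p m =
     real ((p - 1) choose m) * real (p choose (m + 1)) / real ((2 * p - 1) choose p)"

text \<open>The Jiang--Shu smoothness indicator on cell 0, and the nonlinear weights with exponent 2.\<close>

definition weno_smoothness :: "nat \<Rightarrow> (int \<Rightarrow> real) \<Rightarrow> nat \<Rightarrow> real" where
  "weno_smoothness p v m =
     (\<Sum>l=1..p - 1. integral {-1/2..1/2::real}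
        (\<lambda>y. (poly ((pderiv ^^ l) (recon_poly (- int m) p v)) y)\<^sup>2))"

definition weno_unnormalized :: "real \<Rightarrow> nat \<Rightarrow> (int \<Rightarrow> real) \<Rightarrow> nat \<Rightarrow> real" where
  "weno_unnormalized \<epsilon> p v m = weno_linear p m / (\<epsilon> + weno_smoothness p v m)\<^sup>2"

definition weno_left :: "real \<Rightarrow> nat \<Rightarrow> (int \<Rightarrow> real) \<Rightarrow> real" where
  "weno_left \<epsilon> p v =
     (\<Sum>m<p. weno_unnormalized \<epsilon> p v m / (\<Sum>m'<p. weno_unnormalized \<epsilon> p v m')
             * poly (recon_poly (- int m) p v) (1/2))"

text \<open>The right limit value is obtained by reflecting the data at the interface.\<close>

definition weno_right :: "real \<Rightarrow> nat \<Rightarrow> (int \<Rightarrow> real) \<Rightarrow> real" where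
  "weno_right \<epsilon> p v = weno_left \<epsilon> p (\<lambda>j. v (1 - j))"

definition weno_jump ::
    "real \<Rightarrow> nat \<Rightarrow> (grid \<Rightarrow> vec8) \<Rightarrow> grid \<Rightarrow> 3 \<Rightarrow> vec8" where
  "weno_jump \<epsilon> p a i k = (\<chi> c.
     weno_right \<epsilon> p (\<lambda>n. a (i + axis k n) $ c) - weno_left \<epsilon> p (\<lambda>n. a (i + axis k n) $ c))"

definition jump :: "(grid \<Rightarrow> vec8) \<Rightarrow> grid \<Rightarrow> 3 \<Rightarrow> vec8" where
  "jump a i k = a (i + axis k 1) - a i"

definition mean :: "(grid \<Rightarrow> vec8) \<Rightarrow> grid \<Rightarrow> 3 \<Rightarrow> vec8" where
  "mean a i k = (1/2) *\<^sub>R (a (i + axis k 1) + a i)"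

definition same_sign :: "vec8 \<Rightarrow> vec8 \<Rightarrow> real ^ 8 ^ 8" where
  "same_sign a b = (\<chi> l l'. if l = l' \<and> sgn (a $ l) = sgn (b $ l) then 1 else 0)"

section \<open>Dissipation\<close>

text \<open>\<open>arctan (y / x)\<close>, extended to \<open>x = 0\<close> by its one-sided limit \<open>\<plusminus>\<pi>/2\<close> as \<open>x\<close> decreases to 0
  (and by 0 if both arguments vanish).\<close>

definition arctan_quot :: "real \<Rightarrow> real \<Rightarrow> real" where
  "arctan_quot y x = (if x = 0 then sgn y * (pi / 2) else arctan (y / x))"

definition rot3 :: "vec3 \<Rightarrow> real ^ 3 ^ 3" where
  "rot3 M =
     (let \<theta> = arctan_quot (M $ 2) (M $ 1);
          \<phi> = arctan_quot (M $ 3) (sqrt ((M $ 1)\<^sup>2 + (M $ 2)\<^sup>2)) in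
      vector [vector [cos \<phi> * cos \<theta>, cos \<phi> * sin \<theta>, sin \<phi>],
              vector [- sin \<theta>, cos \<theta>, 0],
              vector [- sin \<phi> * cos \<theta>, - sin \<phi> * sin \<theta>, cos \<phi>]])"

definition rot8 :: "vec3 \<Rightarrow> real ^ 8 ^ 8" where
  "rot8 M = vector [pack8 1 0 0 0,
     pack8 0 (rot3 M $ 1) 0 0, pack8 0 (rot3 M $ 2) 0 0, pack8 0 (rot3 M $ 3) 0 0,
     pack8 0 0 1 0,
     pack8 0 0 0 (rot3 M $ 1), pack8 0 0 0 (rot3 M $ 2), pack8 0 0 0 (rot3 M $ 3)]"

text \<open>On the set of values of \<open>entropy_vars \<Gamma>\<close>, the function \<open>U_of_V \<Gamma>\<close> is \<open>U\<close> as a function of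
  \<open>V\<close>.\<close>

definition U_of_V :: "real \<Rightarrow> vec8 \<Rightarrow> vec8" where
  "U_of_V \<Gamma> = inv_into (admissible \<Gamma>) (entropy_vars \<Gamma>)"

definition diag_mat :: "vec8 \<Rightarrow> real ^ 8 ^ 8" where
  "diag_mat d = (\<chi> a b. if a = b then d $ a else 0)"

definition scaled_eigenvectors ::
    "real \<Rightarrow> (vec8 \<Rightarrow> real ^ 8 ^ 8) \<Rightarrow> (vec8 \<Rightarrow> vec8) \<Rightarrow> bool" where
  "scaled_eigenvectors \<Gamma> R lam \<longleftrightarrow>
     (\<forall>U\<in>admissible \<Gamma>.
        invertible (R U) \<and>
        jacobian (U_of_V \<Gamma>) (at (entropy_vars \<Gamma> U)) = R U ** transpose (R U) \<and>
        jacobian (flux \<Gamma> 1) (at U)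
          + (\<chi> a b. dPhi \<Gamma> U $ a * frechet_derivative (\<lambda>X. mag X $ 1) (at U) (axis b 1))
        = R U ** diag_mat (lam U) ** matrix_inv (R U))"

definition lambda_hat :: "(vec8 \<Rightarrow> vec8) \<Rightarrow> vec8 \<Rightarrow> real \<Rightarrow> vec3 \<Rightarrow> real" where
  "lambda_hat lam u mt mx =
     Max (range (\<lambda>m. \<bar>mt + sqrt (\<Sum>j\<in>UNIV. (mx $ j)\<^sup>2) * lam (rot8 mx *v u) $ m\<bar>))"

definition dissipation ::
    "(vec8 \<Rightarrow> real ^ 8 ^ 8) \<Rightarrow> (vec8 \<Rightarrow> vec8) \<Rightarrow> vec8 \<Rightarrow> real \<Rightarrow> vec3 \<Rightarrow> real ^ 8 ^ 8" where
  "dissipation R lam u mt mx =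
     lambda_hat lam u mt mx *\<^sub>R (matrix_inv (rot8 mx) ** R (rot8 mx *v u))"

text \<open>The scaled entropy variables of the grid function \<open>U\<close>, for the frozen interface state \<open>u\<close> and
  metrics \<open>mx\<close>.\<close>

definition scaled_vars ::
    "real \<Rightarrow> (vec8 \<Rightarrow> real ^ 8 ^ 8) \<Rightarrow> vec8 \<Rightarrow> vec3 \<Rightarrow> (grid \<Rightarrow> vec8) \<Rightarrow> grid \<Rightarrow> vec8" where
  "scaled_vars \<Gamma> R u mx U i =
     transpose (R (rot8 mx *v u)) *v (rot8 mx *v entropy_vars \<Gamma> (U i))"

section \<open>The entropy stable fluxes\<close>

text \<open>\<open>Uf i k\<close>, \<open>Mtf i k\<close> and \<open>Mxf i k\<close> are the interface values of the state and of the metrics.\<close>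

definition limited_jump ::
    "real \<Rightarrow> real \<Rightarrow> nat \<Rightarrow> (vec8 \<Rightarrow> real ^ 8 ^ 8) \<Rightarrow> (grid \<Rightarrow> vec8) \<Rightarrow>
     (grid \<Rightarrow> 3 \<Rightarrow> vec8) \<Rightarrow> (grid \<Rightarrow> 3 \<Rightarrow> vec3) \<Rightarrow> grid \<Rightarrow> 3 \<Rightarrow> vec8" where
  "limited_jump \<Gamma> \<epsilon> p R U Uf Mxf i k =
     (let Vt = scaled_vars \<Gamma> R (Uf i k) (Mxf i k) U in
      same_sign (weno_jump \<epsilon> p Vt i k) (jump Vt i k) *v weno_jump \<epsilon> p Vt i k)"

definition flux_hat ::
    "real \<Rightarrow> real \<Rightarrow> nat \<Rightarrow> (nat \<Rightarrow> real) \<Rightarrow> (vec8 \<Rightarrow> vec8 \<Rightarrow> vec8) \<Rightarrow> (3 \<Rightarrow> vec8 \<Rightarrow> vec8 \<Rightarrow> vec8) \<Rightarrow>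
     (vec8 \<Rightarrow> real ^ 8 ^ 8) \<Rightarrow> (vec8 \<Rightarrow> vec8) \<Rightarrow> (grid \<Rightarrow> 3 \<Rightarrow> real) \<Rightarrow> (grid \<Rightarrow> 3 \<Rightarrow> vec3) \<Rightarrow>
     (grid \<Rightarrow> vec8) \<Rightarrow> (grid \<Rightarrow> 3 \<Rightarrow> vec8) \<Rightarrow> (grid \<Rightarrow> 3 \<Rightarrow> real) \<Rightarrow> (grid \<Rightarrow> 3 \<Rightarrow> vec3) \<Rightarrow>
     grid \<Rightarrow> 3 \<Rightarrow> vec8" where
  "flux_hat \<Gamma> \<epsilon> p \<alpha> Ut Ft R lam Mt Mx U Uf Mtf Mxf i k =
     high_order p \<alpha> (flux2 Ut Ft Mt Mx U) i k
     - (1/2) *\<^sub>R (dissipation R lam (Uf i k) (Mtf i k) (Mxf i k)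
                   *v limited_jump \<Gamma> \<epsilon> p R U Uf Mxf i k)"

definition entropy_flux_hat ::
    "real \<Rightarrow> real \<Rightarrow> nat \<Rightarrow> (nat \<Rightarrow> real) \<Rightarrow> (vec8 \<Rightarrow> vec8 \<Rightarrow> vec8) \<Rightarrow> (3 \<Rightarrow> vec8 \<Rightarrow> vec8 \<Rightarrow> vec8) \<Rightarrow>
     (vec8 \<Rightarrow> real ^ 8 ^ 8) \<Rightarrow> (vec8 \<Rightarrow> vec8) \<Rightarrow> (grid \<Rightarrow> 3 \<Rightarrow> real) \<Rightarrow> (grid \<Rightarrow> 3 \<Rightarrow> vec3) \<Rightarrow>
     (grid \<Rightarrow> vec8) \<Rightarrow> (grid \<Rightarrow> 3 \<Rightarrow> vec8) \<Rightarrow> (grid \<Rightarrow> 3 \<Rightarrow> real) \<Rightarrow> (grid \<Rightarrow> 3 \<Rightarrow> vec3) \<Rightarrow>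
     grid \<Rightarrow> 3 \<Rightarrow> real" where
  "entropy_flux_hat \<Gamma> \<epsilon> p \<alpha> Ut Ft R lam Mt Mx U Uf Mtf Mxf i k =
     high_order p \<alpha> (entropy_flux2 \<Gamma> Ut Ft Mt Mx U) i k
     - 1/2 * lambda_hat lam (Uf i k) (Mtf i k) (Mxf i k)
       * (mean (scaled_vars \<Gamma> R (Uf i k) (Mxf i k) U) i k \<bullet> limited_jump \<Gamma> \<epsilon> p R U Uf Mxf i k)"

text \<open>The sum over the three directions of the difference quotients of an interface quantity.\<close>

definition flux_div :: "vec3 \<Rightarrow> (grid \<Rightarrow> 3 \<Rightarrow> 'a::real_vector) \<Rightarrow> grid \<Rightarrow> 'a" where
  "flux_div \<Delta> G i = (\<Sum>k\<in>UNIV. (1 / \<Delta> $ k) *\<^sub>R (G i k - G (i - axis k 1) k))"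

end

theory Submission
  imports Defs
begin

text \<open>Smoothness of the two-point fluxes and the identity for \<open>Ut\<close> already force \<open>\<eta>\<close> to have gradient
  \<open>V\<close> along admissible states, so contracting the scheme with \<open>V\<close> gives the rate of change of
  \<open>J \<eta>\<close>. Up to the potentials \<open>\<psi>\<^sub>j\<close>, each two-point contribution is in entropy balance, and the
  terms with \<open>\<psi>\<^sub>j\<close> sum to zero because the discrete metrics satisfy the geometric conservation law.
  Since the rotation \<open>T\<close> is orthogonal, the dissipation at an interface contributes to each of
  the two neighbouring points \<open>-\<lambda>/4\<close> times the inner product of the jump of the scaled variables
  with the limited WENO jump, which the sign switch makes nonpositive. Nothing about the WENO
  reconstruction itself enters.\<close>

section \<open>Coordinates and block vectors in dimension eight\<close>

lemma UNIV_8: "(UNIV :: 8 set) = {1, 2, 3, 4, 5, 6, 7, 8}"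
proof -
  have "x \<in> {1, 2, 3, 4, 5, 6, 7, 8}" for x :: 8
  proof (cases x)
    case (of_int z)
    \<comment> \<open>The representatives run from 0 to 7, and \<open>z = 0\<close> is the element
      written \<open>8\<close>.\<close>
    then have "z = 0 \<or> z = 1 \<or> z = 2 \<or> z = 3 \<or> z = 4 \<or> z = 5 \<or> z = 6 \<or> z = 7"
      by auto
    then show ?thesis using of_int by auto
  qed
  then show ?thesis by auto
qed

lemma forall_8: "(\<forall>i::8. P i) \<longleftrightarrow>
    P 1 \<and> P 2 \<and> P 3 \<and> P 4 \<and> P 5 \<and> P 6 \<and> P 7 \<and> P 8"
proof -
  have "(\<forall>i::8. P i) \<longleftrightarrow> (\<forall>i\<in>{1, 2, 3, 4, 5, 6, 7, 8}. P i)"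
    by (simp flip: UNIV_8)
  then show ?thesis by simp
qed

lemma sum_8: "sum f (UNIV::8 set) = f 1 + f 2 + f 3 + f 4 + f 5 + f 6 + f 7 + f 8"
  unfolding UNIV_8 by (simp add: ac_simps)

lemma vector_8 [simp]:
  "(vector [a, b, c, d, e, f, g, h] :: 'a::zero ^ 8) $ 1 = a"
  "(vector [a, b, c, d, e, f, g, h] :: 'a ^ 8) $ 2 = b"
  "(vector [a, b, c, d, e, f, g, h] :: 'a ^ 8) $ 3 = c"
  "(vector [a, b, c, d, e, f, g, h] :: 'a ^ 8) $ 4 = d"
  "(vector [a, b, c, d, e, f, g, h] :: 'a ^ 8) $ 5 = e"
  "(vector [a, b, c, d, e, f, g, h] :: 'a ^ 8) $ 6 = f"
  "(vector [a, b, c, d, e, f, g, h] :: 'a ^ 8) $ 7 = g"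
  "(vector [a, b, c, d, e, f, g, h] :: 'a ^ 8) $ 8 = h"
  unfolding vector_def by simp_all

lemma inner_pack8:
  "pack8 a m e b \<bullet> pack8 a' m' e' b' = a * a' + m \<bullet> m' + e * e' + b \<bullet> b'"
  by (simp add: pack8_def inner_vec_def sum_8 sum_3)

lemma continuous_on_pack8:
  assumes "continuous_on S a" "continuous_on S m" "continuous_on S e" "continuous_on S b"
  shows "continuous_on S (\<lambda>x. pack8 (a x) (m x) (e x) (b x))"
proof -
  have "\<forall>i. continuous_on S (\<lambda>x. pack8 (a x) (m x) (e x) (b x) $ i)"
    unfolding forall_8 pack8_def using assms by (auto intro!: continuous_intros)
  then show ?thesis
    unfolding continuous_on_def by (auto intro: vec_tendstoI)
qed

section \<open>Continuity of the entropy variables\<close>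

lemma lorentz_pos: "norm v < 1 \<Longrightarrow> lorentz v > 0"
  by (simp add: lorentz_def power_less_one_iff abs_square_less_1)

lemma inverse_lorentz_square:
  assumes "norm v < 1"
  shows "1 / (lorentz v)\<^sup>2 = 1 - v \<bullet> v"
proof -
  have "(norm v)\<^sup>2 \<le> 1" using assms by (simp add: abs_square_le_1)
  then show ?thesis by (simp add: lorentz_def power_divide power2_norm_eq_inner)
qed

lemma continuous_on_lorentz:
  assumes "continuous_on S v" "\<And>x. x \<in> S \<Longrightarrow> norm (v x) < 1"
  shows "continuous_on S (\<lambda>x. lorentz (v x))"
proof -
  have "1 - (norm (v x))\<^sup>2 > 0" if "x \<in> S" for x
    using assms(2)[OF that] by (simp add: abs_square_less_1)
  then show ?thesis
    unfolding lorentz_def using assms(1)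
    by (intro continuous_intros) (auto simp: less_le)
qed

text \<open>\<open>prim \<Gamma> U\<close> is a chosen preimage of \<open>U\<close>, so it lies in
  \<open>prim_states\<close> and \<open>conservative \<Gamma>\<close> maps it back to
  \<open>U\<close>. The formula for \<open>U $ 1\<close> is the first component of that
  identity.\<close>

lemma admissibleD:
  assumes "U \<in> admissible \<Gamma>"
  shows "dens \<Gamma> U > 0" "pgas \<Gamma> U > 0" "norm (vel \<Gamma> U) < 1"
    and "U $ 1 = dens \<Gamma> U * lorentz (vel \<Gamma> U)" "U $ 1 > 0"
proof -
  have P: "prim \<Gamma> U \<in> prim_states" and C: "conservative \<Gamma> (prim \<Gamma> U) = U"
    using assms unfolding admissible_def prim_def by (auto intro: inv_into_into f_inv_into_f)
  show *: "dens \<Gamma> U > 0" "pgas \<Gamma> U > 0" "norm (vel \<Gamma> U) < 1"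
    using P by (auto simp: dens_def vel_def pgas_def prim_states_def)
  have "U $ 1 = conservative \<Gamma> (prim \<Gamma> U) $ 1"
    by (simp add: C)
  also have "\<dots> = dens \<Gamma> U * lorentz (vel \<Gamma> U)"
    by (simp add: conservative_def dens_def vel_def pack8_def Let_def split_beta)
  finally show "U $ 1 = dens \<Gamma> U * lorentz (vel \<Gamma> U)" .
  then show "U $ 1 > 0" using * lorentz_pos by simp
qed

lemma smooth_symmetric_consistent_diag:
  assumes "smooth_symmetric_consistent \<Gamma> G g" "a \<in> admissible \<Gamma>"
  shows "G a a = g a"
  using assms by (auto simp: smooth_symmetric_consistent_def)

text \<open>By consistency \<open>g\<close> is the restriction of \<open>G\<close> to the diagonal,
  and smoothness of \<open>G\<close> includes continuity as \<open>Ck_on 0\<close>.\<close>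

lemma continuous_on_consistent:
  assumes "smooth_symmetric_consistent \<Gamma> G g"
  shows "continuous_on (admissible \<Gamma>) g"
proof -
  have "Ck_on 0 (\<lambda>(a, b). G a b) (admissible \<Gamma> \<times> admissible \<Gamma>)"
    using assms unfolding smooth_symmetric_consistent_def smooth_on_def by blast
  then have "continuous_on (admissible \<Gamma> \<times> admissible \<Gamma>) (\<lambda>(a, b). G a b)"
    by simp
  then have "continuous_on (admissible \<Gamma>) (\<lambda>u. (\<lambda>(a, b). G a b) (u, u))"
    by (rule continuous_on_compose2) (auto intro!: continuous_intros)
  then show ?thesis
    by (rule continuous_on_eq) (simp add: smooth_symmetric_consistent_diag[OF assms])
qed

text \<open>Continuity of the primitive variables is read off from that of the physical fluxes, which
  consistency transfers from the two-point fluxes. This avoids any analysis of the inverse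
  of \<open>conservative \<Gamma>\<close>, of which not even injectivity is needed.\<close>

lemma
  assumes F: "\<And>k. continuous_on (admissible \<Gamma>) (flux \<Gamma> k)"
  shows continuous_on_vel: "continuous_on (admissible \<Gamma>) (vel \<Gamma>)"
    and continuous_on_pgas: "continuous_on (admissible \<Gamma>) (pgas \<Gamma>)"
    and continuous_on_dens: "continuous_on (admissible \<Gamma>) (dens \<Gamma>)"
    and continuous_on_mag: "continuous_on (admissible \<Gamma>) mag"
proof -
  let ?A = "admissible \<Gamma>"
  have "continuous_on ?A (\<lambda>U. vel \<Gamma> U $ k)" for k
  proof (rule continuous_on_eq)
    \<comment> \<open>The first flux component is \<open>D * v $ k\<close>, and
      \<open>D = U $ 1\<close> is positive.\<close>
    show "continuous_on ?A (\<lambda>U. flux \<Gamma> k U $ 1 / U $ 1)"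
      using F admissibleD(5) by (intro continuous_intros) (auto simp: less_le)
    show "flux \<Gamma> k U $ 1 / U $ 1 = vel \<Gamma> U $ k" if "U \<in> ?A" for U
      using admissibleD(5)[OF that] by (simp add: flux_def pack8_def Let_def)
  qed
  then show v: "continuous_on ?A (vel \<Gamma>)"
    unfolding continuous_on_def by (auto intro: vec_tendstoI)
  have W: "continuous_on ?A (\<lambda>U. lorentz (vel \<Gamma> U))"
    using v admissibleD(3) by (rule continuous_on_lorentz)
  have Wn: "lorentz (vel \<Gamma> U) \<noteq> 0" if "U \<in> ?A" for U
    using lorentz_pos[OF admissibleD(3)[OF that]] by simp
  have "continuous_on ?A (\<lambda>U. mag U $ k)" for k
    using exhaust_3[of k] by (elim disjE; simp add: mag_def; intro continuous_intros)
  then show B: "continuous_on ?A mag"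
    unfolding continuous_on_def by (auto intro: vec_tendstoI)
  show "continuous_on ?A (dens \<Gamma>)"
  proof (rule continuous_on_eq)
    show "continuous_on ?A (\<lambda>U. U $ 1 / lorentz (vel \<Gamma> U))"
      using W Wn by (intro continuous_intros) auto
    show "U $ 1 / lorentz (vel \<Gamma> U) = dens \<Gamma> U" if "U \<in> ?A" for U
      using admissibleD(4)[OF that] Wn[OF that] by simp
  qed
  show "continuous_on ?A (pgas \<Gamma>)"
  proof (rule continuous_on_eq)
    \<comment> \<open>The gas pressure is isolated from the first momentum component of the flux in
      direction 1, the one in which the total pressure appears.\<close>
    let ?p = "\<lambda>U. flux \<Gamma> 1 U $ 2 - (vel \<Gamma> U $ 1 * U $ 2 - mag U $ 1 *
        (1 / (lorentz (vel \<Gamma> U))\<^sup>2 * mag U $ 1 + (vel \<Gamma> U \<bullet> mag U) * vel \<Gamma> U $ 1))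
      - ((norm (mag U))\<^sup>2 / (lorentz (vel \<Gamma> U))\<^sup>2 + (vel \<Gamma> U \<bullet> mag U)\<^sup>2) / 2"
    show "continuous_on ?A ?p"
      using F v W Wn B by (intro continuous_intros) auto
    show "?p U = pgas \<Gamma> U" for U
      by (simp add: flux_def pack8_def Let_def momentum_def p_total_def axis_def)
  qed
qed

lemma continuous_on_entropy_vars:
  assumes F: "\<And>k. continuous_on (admissible \<Gamma>) (flux \<Gamma> k)"
  shows "continuous_on (admissible \<Gamma>) (entropy_vars \<Gamma>)"
proof -
  note c = continuous_on_vel[OF F] continuous_on_pgas[OF F] continuous_on_dens[OF F]
    continuous_on_mag[OF F]
  have W: "continuous_on (admissible \<Gamma>) (\<lambda>U. lorentz (vel \<Gamma> U))"
    using c(1) admissibleD(3) by (rule continuous_on_lorentz)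
  have n: "lorentz (vel \<Gamma> U) \<noteq> 0" "pgas \<Gamma> U \<noteq> 0" "dens \<Gamma> U \<noteq> 0"
    if "U \<in> admissible \<Gamma>" for U
    using lorentz_pos[OF admissibleD(3)[OF that]] admissibleD(1,2)[OF that] by auto
  have s: "continuous_on (admissible \<Gamma>) (spec_entropy \<Gamma>)"
    unfolding spec_entropy_def using c n by (intro continuous_intros) auto
  show ?thesis
    unfolding entropy_vars_def Let_def using c W n s
    \<comment> \<open>\<Gamma> is arbitrary here. For \<open>\<Gamma> = 1\<close> the quotient by
      \<open>\<Gamma> - 1\<close> is 0 by convention, which is continuous too.\<close>
    by (cases "\<Gamma> = 1"; intro continuous_on_pack8) (auto intro!: continuous_intros)
qed

section \<open>The gradient of the entropy\<close>

text \<open>For \<open>V = entropy_vars \<Gamma>\<close>, the condition on \<open>Ut\<close> says that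
  \<open>\<eta>(y) - \<eta>(u) - V(u) \<bullet> (y - u) = (V(y) - V(u)) \<bullet> (y - Ut u y)\<close>, where the first factor tends
  to 0 and the second one is \<open>O(y - u)\<close>.\<close>

lemma eta_has_derivative:
  assumes tp: "two_point_fluxes \<Gamma> Ut Ft" and u: "u \<in> admissible \<Gamma>"
  shows "(eta \<Gamma> has_derivative (\<lambda>h. entropy_vars \<Gamma> u \<bullet> h)) (at u within admissible \<Gamma>)"
proof -
  let ?A = "admissible \<Gamma>" and ?V = "entropy_vars \<Gamma>"
  have ssc: "smooth_symmetric_consistent \<Gamma> Ut (\<lambda>u. u)"
    "\<And>k. smooth_symmetric_consistent \<Gamma> (Ft k) (flux \<Gamma> k)"
    using tp by (auto simp: two_point_fluxes_def)
  have "Ck_on 1 (\<lambda>(a, b). Ut a b) (?A \<times> ?A)"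
    using ssc(1) by (auto simp only: smooth_symmetric_consistent_def smooth_on_def)
  \<comment> \<open>\<open>Ck_on\<close> differentiates in the whole space, so freezing the first
    argument at \<open>u\<close> gives an unrestricted derivative of \<open>Ut u\<close> at
    \<open>u\<close>.\<close>
  then obtain D where "((\<lambda>(a, b). Ut a b) has_derivative D) (at (u, u))"
    using u by auto
  moreover have "((\<lambda>y. (u, y)) has_derivative (\<lambda>h. (0, h))) (at u)"
    by (auto intro!: derivative_eq_intros)
  ultimately have "((\<lambda>y. Ut u y) has_derivative (\<lambda>h. D (0, h))) (at u)"
    using has_derivative_compose[of "\<lambda>y. (u, y)" "\<lambda>h. (0, h)" u UNIV "\<lambda>(a, b). Ut a b" D] by simp
  then have g: "((\<lambda>y. y - Ut u y) has_derivative (\<lambda>h. h - D (0, h))) (at u)"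
    by (auto intro!: derivative_eq_intros)
  let ?g' = "\<lambda>h. h - D (0, h)"
  have "bounded_linear ?g'" using g by (rule has_derivative_bounded_linear)
  then obtain K where K: "K > 0" "\<And>h. norm (?g' h) \<le> norm h * K"
    using bounded_linear.pos_bounded by blast
  have "\<exists>d>0. \<forall>y. norm (y - u) < d \<longrightarrow>
      norm ((y - Ut u y) - (u - Ut u u) - ?g' (y - u)) \<le> 1 * norm (y - u)"
    using g unfolding has_derivative_at_alt by (meson zero_less_one)
  then obtain d1 where d1: "d1 > 0" "\<And>y. norm (y - u) < d1 \<Longrightarrow>
      norm ((y - Ut u y) - (u - Ut u u) - ?g' (y - u)) \<le> 1 * norm (y - u)"
    by blast
  \<comment> \<open>Since \<open>Ut u u = u\<close>, the map vanishes at \<open>u\<close>. The error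
    bound with tolerance 1 and the bound \<open>K\<close> on its derivative add up to the factor
    \<open>1 + K\<close>.\<close>
  have g_le: "norm (y - Ut u y) \<le> (1 + K) * norm (y - u)" if "norm (y - u) < d1" for y
  proof -
    have "norm (y - Ut u y - ?g' (y - u)) \<le> norm (y - u)"
      using d1(2)[OF that] smooth_symmetric_consistent_diag[OF ssc(1) u] by simp
    then show ?thesis
      using K(2)[of "y - u"] norm_triangle_sub[of "y - Ut u y" "?g' (y - u)"]
      by (simp add: algebra_simps)
  qed
  \<comment> \<open>Continuity of \<open>?V\<close> is established on \<open>?A\<close>, hence the
    derivative of \<open>eta\<close> within \<open>?A\<close>.\<close>
  have contV: "continuous_on ?A ?V"
    by (intro continuous_on_entropy_vars continuous_on_consistent[OF ssc(2)])
  show ?thesis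
    unfolding has_derivative_within_alt
  proof (intro conjI allI impI)
    show "bounded_linear (\<lambda>h. ?V u \<bullet> h)" by (rule bounded_linear_inner_right)
    fix e :: real assume "e > 0"
    \<comment> \<open>This tolerance for \<open>?V\<close> cancels the factor \<open>1 + K\<close>
      of \<open>g_le\<close>.\<close>
    then have "e / (1 + K) > 0" using K by simp
    then obtain d2 where d2: "d2 > 0" "\<And>y. y \<in> ?A \<Longrightarrow> dist y u < d2 \<Longrightarrow> dist (?V y) (?V u) < e / (1 + K)"
      using contV u unfolding continuous_on_iff by blast
    have "norm (eta \<Gamma> y - eta \<Gamma> u - ?V u \<bullet> (y - u)) \<le> e * norm (y - u)"
      if y: "y \<in> ?A" and n: "norm (y - u) < min d1 d2" for y
    proof -
      have "(?V y - ?V u) \<bullet> Ut u y = pot_phi \<Gamma> y - pot_phi \<Gamma> u"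
        using tp u y by (simp add: two_point_fluxes_def)
      then have "eta \<Gamma> y - eta \<Gamma> u - ?V u \<bullet> (y - u) = (?V y - ?V u) \<bullet> (y - Ut u y)"
        by (simp add: pot_phi_def inner_diff_left inner_diff_right)
      also have "norm \<dots> \<le> norm (?V y - ?V u) * norm (y - Ut u y)"
        by (simp add: Cauchy_Schwarz_ineq2)
      also have "\<dots> \<le> e / (1 + K) * ((1 + K) * norm (y - u))"
        using d2(2)[OF y] n K \<open>e > 0\<close> by (intro mult_mono g_le) (auto simp: dist_norm)
      also have "\<dots> = e * norm (y - u)" using K by simp
      finally show ?thesis .
    qed
    then show "\<exists>d>0. \<forall>y\<in>?A. norm (y - u) < d \<longrightarrow>
        norm (eta \<Gamma> y - eta \<Gamma> u - ?V u \<bullet> (y - u)) \<le> e * norm (y - u)"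
      using d1(1) d2(1) by (intro exI[of _ "min d1 d2"]) auto
  qed
qed

text \<open>Euler's identity for a function homogeneous of degree one. As
  \<open>1 / W\<^sup>2 + v \<bullet> v = 1\<close>, the momentum and magnetic blocks each contribute
  \<open>Phi\<close>, and the energy component contributes its negative.\<close>

lemma entropy_vars_inner_dPhi:
  assumes "U \<in> admissible \<Gamma>"
  shows "entropy_vars \<Gamma> U \<bullet> dPhi \<Gamma> U = Phi \<Gamma> U"
proof -
  define v W B \<rho> p where defs: "v = vel \<Gamma> U" "W = lorentz v" "B = mag U" "\<rho> = dens \<Gamma> U" "p = pgas \<Gamma> U"
  have W: "W > 0" "1 / W\<^sup>2 = 1 - v \<bullet> v" and p: "p > 0"
    using admissibleD[OF assms] by (auto simp: defs lorentz_pos inverse_lorentz_square)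
  have "entropy_vars \<Gamma> U \<bullet> dPhi \<Gamma> U =
      (\<rho> * W / p) * (1 / W\<^sup>2 * (v \<bullet> B) + (v \<bullet> B) * (v \<bullet> v)) - \<rho> * W / p * (v \<bullet> B)
      + \<rho> / (p * W) * (v \<bullet> B + W\<^sup>2 * (v \<bullet> B) * (v \<bullet> v))"
    unfolding entropy_vars_def dPhi_def Let_def inner_pack8 defs[symmetric]
      inner_add_right inner_add_left inner_scaleR_left inner_scaleR_right inner_commute[of B v]
    by (simp add: distrib_left mult_ac)
  also have "\<rho> / (p * W) * (v \<bullet> B + W\<^sup>2 * (v \<bullet> B) * (v \<bullet> v))
      = (\<rho> * W / p) * (1 / W\<^sup>2 * (v \<bullet> B) + (v \<bullet> B) * (v \<bullet> v))"
    using W(1) p by (simp add: field_simps power2_eq_square)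
  finally show ?thesis
    unfolding W(2) by (simp add: algebra_simps Phi_def defs)
qed

text \<open>The chain rule gives \<open>J * U' = A - B * U\<close>, so the product rule yields
  \<open>V \<bullet> A - B * (V \<bullet> U - eta)\<close>, and the bracket is
  \<open>pot_phi\<close>.\<close>

lemma weighted_eta_has_derivative:
  assumes tp: "two_point_fluxes \<Gamma> Ut Ft" and t: "t \<in> I"
    and J: "\<And>t. t \<in> I \<Longrightarrow> J t > 0" and U: "\<And>t. t \<in> I \<Longrightarrow> U t \<in> admissible \<Gamma>"
    and dJU: "((\<lambda>t. J t *\<^sub>R U t) has_vector_derivative A) (at t within I)"
    and dJ: "(J has_real_derivative B) (at t within I)"
  shows "((\<lambda>t. J t * eta \<Gamma> (U t)) has_real_derivative
    entropy_vars \<Gamma> (U t) \<bullet> A - pot_phi \<Gamma> (U t) * B) (at t within I)"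
proof -
  note Jt = J[OF t]
  have inv: "((\<lambda>t. 1 / J t) has_real_derivative - B / (J t)\<^sup>2) (at t within I)"
    unfolding divide_inverse mult_1_left
    by (rule DERIV_cong[OF DERIV_inverse'[OF dJ]]) (use Jt in \<open>simp_all add: power2_eq_square\<close>)
  \<comment> \<open>Only \<open>J\<close> and the product \<open>J U\<close> are known to be
    differentiable, so \<open>U\<close> is recovered as their quotient.\<close>
  have U_eq: "U s = (1 / J s) *\<^sub>R (J s *\<^sub>R U s)" if "s \<in> I" for s
    using J[OF that] by simp
  have "((\<lambda>t. (1 / J t) *\<^sub>R (J t *\<^sub>R U t)) has_vector_derivative
      (1 / J t) *\<^sub>R A + (- B / (J t)\<^sup>2) *\<^sub>R (J t *\<^sub>R U t)) (at t within I)"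
    by (intro has_vector_derivative_scaleR inv dJU)
  then have "(U has_vector_derivative
      (1 / J t) *\<^sub>R A + (- B / (J t)\<^sup>2) *\<^sub>R (J t *\<^sub>R U t)) (at t within I)"
    by (rule has_vector_derivative_transform[OF t, rotated]) (rule U_eq)
  moreover have "(1 / J t) *\<^sub>R A + (- B / (J t)\<^sup>2) *\<^sub>R (J t *\<^sub>R U t) = (1 / J t) *\<^sub>R (A - B *\<^sub>R U t)"
    (is "_ = ?U'")
    using Jt by (simp add: power2_eq_square scaleR_diff_right)
  ultimately have dU: "(U has_vector_derivative ?U') (at t within I)"
    by simp
  \<comment> \<open>The curve stays admissible, so the derivative within the admissible set
    restricts to its image, as the chain rule requires.\<close>
  have "(eta \<Gamma> has_derivative (\<lambda>h. entropy_vars \<Gamma> (U t) \<bullet> h)) (at (U t) within U ` I)"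
    by (rule has_derivative_subset[OF eta_has_derivative[OF tp U[OF t]]]) (use U in blast)
  then have "((\<lambda>t. eta \<Gamma> (U t)) has_derivative (\<lambda>s. entropy_vars \<Gamma> (U t) \<bullet> (s *\<^sub>R ?U'))) (at t within I)"
    using dU unfolding has_vector_derivative_def by (rule has_derivative_in_compose[rotated])
  then have deta: "((\<lambda>t. eta \<Gamma> (U t)) has_real_derivative entropy_vars \<Gamma> (U t) \<bullet> ?U') (at t within I)"
    unfolding has_field_derivative_def
    by (rule has_derivative_eq_rhs) (simp add: fun_eq_iff mult.commute)
  have eq: "(entropy_vars \<Gamma> (U t) \<bullet> ?U') * J t =
      entropy_vars \<Gamma> (U t) \<bullet> A - B * (entropy_vars \<Gamma> (U t) \<bullet> U t)"
    using Jt by (simp add: inner_diff_right)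
  show ?thesis
    by (rule DERIV_cong[OF DERIV_mult[OF dJ deta]])
      (unfold eq pot_phi_def, simp add: left_diff_distrib right_diff_distrib mult.commute)
qed

section \<open>High-order fluxes and discrete metrics\<close>

text \<open>Moving \<open>i\<close> back by one in direction \<open>k\<close> amounts to raising
  \<open>s\<close> by one. Each inner sum therefore telescopes, leaving the pairs for
  \<open>s = 0\<close> and \<open>s = n\<close>.\<close>

lemma high_order_diff:
  "high_order p \<alpha> G i k - high_order p \<alpha> G (i - axis k 1) k =
    (\<Sum>n=1..p. \<alpha> n *\<^sub>R (G k i (i + axis k (int n)) - G k (i - axis k (int n)) i))"
proof -
  have axis: "axis k (0::int) = 0" "axis k (- a) = - axis k a" for a :: int
    by (simp_all add: vec_eq_iff axis_def)
  have "(\<Sum>s<n. G k (i + axis k (- int s)) (i + axis k (- int s + int n)))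
      - (\<Sum>s<n. G k (i - axis k 1 + axis k (- int s)) (i - axis k 1 + axis k (- int s + int n)))
      = G k i (i + axis k (int n)) - G k (i - axis k (int n)) i" for n
  proof -
    let ?f = "\<lambda>s. G k (i + axis k (- int s)) (i + axis k (- int s + int n))"
    have shift: "i - axis k 1 + axis k (- int s) = i + axis k (- int (Suc s))"
      "i - axis k 1 + axis k (- int s + int n) = i + axis k (- int (Suc s) + int n)" for s
      by (simp_all add: vec_eq_iff axis_def)
    have "(\<Sum>s<n. ?f s)
      - (\<Sum>s<n. G k (i - axis k 1 + axis k (- int s)) (i - axis k 1 + axis k (- int s + int n)))
      = (\<Sum>s<n. ?f s - ?f (Suc s))"
      unfolding shift by (rule sum_subtractf[symmetric])
    also have "\<dots> = ?f 0 - ?f n" by (rule sum_lessThan_telescope')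
    finally show ?thesis by (simp add: axis)
  qed
  then show ?thesis
    unfolding high_order_def sum_subtractf[symmetric] scaleR_diff_right[symmetric] by simp
qed

text \<open>Grid shifts commute; this is the discrete symmetry of mixed derivatives.\<close>

lemma central_diff_commute:
  "central_diff p \<alpha> k (central_diff p \<alpha> k' a) i = central_diff p \<alpha> k' (central_diff p \<alpha> k a) i"
  unfolding central_diff_def sum_distrib_left sum_subtractf[symmetric]
  by (subst sum.swap) (simp add: algebra_simps)

lemma central_diff_scale_diff:
  "central_diff p \<alpha> k (\<lambda>i. c * (a i - b i)) i = c * (central_diff p \<alpha> k a i - central_diff p \<alpha> k b i)"
  by (simp add: central_diff_def sum_distrib_left algebra_simps flip: sum_subtractf)

text \<open>The discrete geometric conservation law: the mixed differences cancel in pairs.\<close>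

lemma metric_x_gcl:
  "(\<Sum>k\<in>UNIV. 1 / \<Delta> $ k * central_diff p \<alpha> k (\<lambda>i. metric_x p \<alpha> \<Delta> x i k $ j) i) = 0"
proof -
  have wrap: "3 + 1 = (1::3)" "3 + 2 = (2::3)" "2 + 2 = (1::3)"
    "2 + 1 = (3::3)" "1 + 2 = (3::3)" "1 + 1 = (2::3)"
    by simp_all
  show ?thesis
    \<comment> \<open>The oriented instances of \<open>central_diff_commute\<close> move the smaller
      direction outermost, so that equal mixed differences become syntactically equal.\<close>
    unfolding metric_x_def vec_lambda_beta central_diff_scale_diff sum_3 wrap
      central_diff_commute[of p \<alpha> 2 1] central_diff_commute[of p \<alpha> 3 1]
      central_diff_commute[of p \<alpha> 3 2]
    by (simp add: diff_divide_distrib mult_ac)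
qed

section \<open>Entropy balance of the two-point fluxes\<close>

lemma flux2_commute:
  assumes "two_point_fluxes \<Gamma> Ut Ft" "U l \<in> admissible \<Gamma>" "U r \<in> admissible \<Gamma>"
  shows "flux2 Ut Ft Mt Mx U k l r = flux2 Ut Ft Mt Mx U k r l"
proof -
  have "Ut (U l) (U r) = Ut (U r) (U l)" "\<And>j. Ft j (U l) (U r) = Ft j (U r) (U l)"
    using assms unfolding two_point_fluxes_def smooth_symmetric_consistent_def by blast+
  then show ?thesis by (simp add: flux2_def add.commute)
qed

lemma entropy_flux2_commute:
  assumes "two_point_fluxes \<Gamma> Ut Ft" "U l \<in> admissible \<Gamma>" "U r \<in> admissible \<Gamma>"
  shows "entropy_flux2 \<Gamma> Ut Ft Mt Mx U k l r = entropy_flux2 \<Gamma> Ut Ft Mt Mx U k r l"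
  unfolding entropy_flux2_def flux2_commute[of \<Gamma> Ut Ft U l r, OF assms] by (simp add: add.commute)

lemma mag2_commute: "mag2 Mx U k l r = mag2 Mx U k r l"
  by (simp add: mag2_def add.commute)

lemma metric_t2_commute: "metric_t2 Mt k l r = metric_t2 Mt k r l"
  by (simp add: metric_t2_def add.commute)

text \<open>The averaged entropy variables are the left ones plus half the jump, and the two-point
  conditions turn that jump against \<open>flux2\<close> into jumps of the potentials. All terms in
  \<open>pot_phi\<close> and \<open>Phi\<close> cancel, and so does \<open>pot_psi\<close> at
  \<open>r\<close>.\<close>

lemma two_point_balance:
  assumes tp: "two_point_fluxes \<Gamma> Ut Ft" and l: "U l \<in> admissible \<Gamma>" and r: "U r \<in> admissible \<Gamma>"
  shows "pot_phi \<Gamma> (U l) * metric_t2 Mt k l r - entropy_vars \<Gamma> (U l) \<bullet> flux2 Ut Ft Mt Mx U k l r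
      - Phi \<Gamma> (U l) * mag2 Mx U k l r + entropy_flux2 \<Gamma> Ut Ft Mt Mx U k l r
    = - (\<Sum>j\<in>UNIV. 1/2 * (Mx l k $ j + Mx r k $ j) * pot_psi \<Gamma> j (U l))"
proof -
  let ?V = "entropy_vars \<Gamma>" and ?F = "flux2 Ut Ft Mt Mx U k l r"
  have "?V (U r) \<bullet> ?F = ?V (U l) \<bullet> ?F +
      1/2 * (Mt l k + Mt r k) * (pot_phi \<Gamma> (U r) - pot_phi \<Gamma> (U l))
      + (\<Sum>j\<in>UNIV. 1/2 * (Mx l k $ j + Mx r k $ j) *
          (pot_psi \<Gamma> j (U r) - pot_psi \<Gamma> j (U l)
           - 1/2 * (mag (U l) $ j + mag (U r) $ j) * (Phi \<Gamma> (U r) - Phi \<Gamma> (U l))))"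
    (is "_ = _ + ?a + ?b")
  proof -
    have "(?V (U r) - ?V (U l)) \<bullet> Ut (U l) (U r) = pot_phi \<Gamma> (U r) - pot_phi \<Gamma> (U l)"
      "(?V (U r) - ?V (U l)) \<bullet> Ft j (U l) (U r) = pot_psi \<Gamma> j (U r) - pot_psi \<Gamma> j (U l)
         - 1/2 * (mag (U l) $ j + mag (U r) $ j) * (Phi \<Gamma> (U r) - Phi \<Gamma> (U l))" for j
      using tp l r unfolding two_point_fluxes_def by blast+
    then have "(?V (U r) - ?V (U l)) \<bullet> ?F = ?a + ?b"
      by (simp only: flux2_def inner_add_right inner_sum_right inner_scaleR_right)
    then show ?thesis by (simp add: inner_diff_left)
  qed
  then show ?thesis
    unfolding entropy_flux2_def mag2_def metric_t2_def sum_3 inner_scaleR_left inner_add_left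
    by (simp add: field_simps)
qed

text \<open>After telescoping, \<open>two_point_balance\<close> applies at the right and left
  neighbours of \<open>i\<close> with \<open>pot_psi\<close> frozen at \<open>U i\<close>. The
  metrics at \<open>i\<close> cancel between the two, leaving central differences of the metrics
  alone.\<close>

lemma high_order_balance:
  fixes i :: grid and k :: 3
  assumes tp: "two_point_fluxes \<Gamma> Ut Ft" and adm: "\<And>i. U i \<in> admissible \<Gamma>"
  defines "\<delta> \<equiv> \<lambda>H. H i k - H (i - axis k 1) k"
  shows "pot_phi \<Gamma> (U i) * \<delta> (high_order p \<alpha> (metric_t2 Mt))
      - entropy_vars \<Gamma> (U i) \<bullet>
          (high_order p \<alpha> (flux2 Ut Ft Mt Mx U) i k
           - high_order p \<alpha> (flux2 Ut Ft Mt Mx U) (i - axis k 1) k)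
      - Phi \<Gamma> (U i) * \<delta> (high_order p \<alpha> (mag2 Mx U))
      + \<delta> (high_order p \<alpha> (entropy_flux2 \<Gamma> Ut Ft Mt Mx U))
    = - (\<Sum>j\<in>UNIV. pot_psi \<Gamma> j (U i) * central_diff p \<alpha> k (\<lambda>i. Mx i k $ j) i)"
proof -
  let ?r = "\<lambda>n::nat. i + axis k (int n)" and ?l = "\<lambda>n::nat. i - axis k (int n)"
  define E where "E r = pot_phi \<Gamma> (U i) * metric_t2 Mt k i r
      - entropy_vars \<Gamma> (U i) \<bullet> flux2 Ut Ft Mt Mx U k i r
      - Phi \<Gamma> (U i) * mag2 Mx U k i r + entropy_flux2 \<Gamma> Ut Ft Mt Mx U k i r" for r
  have E: "E r = - (\<Sum>j\<in>UNIV. 1/2 * (Mx i k $ j + Mx r k $ j) * pot_psi \<Gamma> j (U i))" for r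
    unfolding E_def by (rule two_point_balance[of \<Gamma> Ut Ft U, OF tp adm adm])
  \<comment> \<open>Left neighbours enter the telescoped differences as first argument; symmetry
    puts \<open>i\<close> first, so that both sides are values of \<open>E\<close>.\<close>
  have sym: "flux2 Ut Ft Mt Mx U k (?l n) i = flux2 Ut Ft Mt Mx U k i (?l n)"
    "entropy_flux2 \<Gamma> Ut Ft Mt Mx U k (?l n) i = entropy_flux2 \<Gamma> Ut Ft Mt Mx U k i (?l n)"
    "mag2 Mx U k (?l n) i = mag2 Mx U k i (?l n)" "metric_t2 Mt k (?l n) i = metric_t2 Mt k i (?l n)" for n
    by (rule flux2_commute[of \<Gamma> Ut Ft U, OF tp adm adm]
        entropy_flux2_commute[of \<Gamma> Ut Ft U, OF tp adm adm] mag2_commute metric_t2_commute)+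
  have "pot_phi \<Gamma> (U i) * \<delta> (high_order p \<alpha> (metric_t2 Mt))
      - entropy_vars \<Gamma> (U i) \<bullet>
          (high_order p \<alpha> (flux2 Ut Ft Mt Mx U) i k
           - high_order p \<alpha> (flux2 Ut Ft Mt Mx U) (i - axis k 1) k)
      - Phi \<Gamma> (U i) * \<delta> (high_order p \<alpha> (mag2 Mx U))
      + \<delta> (high_order p \<alpha> (entropy_flux2 \<Gamma> Ut Ft Mt Mx U))
    = (\<Sum>n=1..p. \<alpha> n * (E (?r n) - E (?l n)))"
    unfolding \<delta>_def high_order_diff E_def sym inner_sum_right
    by (simp add: sum_distrib_left sum_distrib_right inner_diff_right algebra_simps
        flip: sum.distrib sum_subtractf)
  also have "\<dots> = (\<Sum>n=1..p. \<Sum>j\<in>UNIV.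
      - pot_psi \<Gamma> j (U i) * (1/2 * (\<alpha> n * (Mx (?r n) k $ j - Mx (?l n) k $ j))))"
    unfolding E sum_3 by (intro sum.cong) (simp_all add: algebra_simps)
  also have "\<dots> = - (\<Sum>j\<in>UNIV. pot_psi \<Gamma> j (U i) * central_diff p \<alpha> k (\<lambda>i. Mx i k $ j) i)"
    by (subst sum.swap) (simp add: central_diff_def sum_distrib_left sum_negf)
  finally show ?thesis .
qed

section \<open>Dissipation\<close>

text \<open>Only \<open>sin\<^sup>2 + cos\<^sup>2 = 1\<close> for the two angles enters, so the
  degenerate values of \<open>arctan_quot\<close> are covered.\<close>

lemma rot3_orthonormal:
  "rot3 M $ a \<bullet> rot3 M $ b = (if a = b then 1 else 0)"
proof -
  define c s c' s' where d: "c = cos (arctan_quot (M $ 2) (M $ 1))" "s = sin (arctan_quot (M $ 2) (M $ 1))"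
    "c' = cos (arctan_quot (M $ 3) (sqrt ((M $ 1)\<^sup>2 + (M $ 2)\<^sup>2)))"
    "s' = sin (arctan_quot (M $ 3) (sqrt ((M $ 1)\<^sup>2 + (M $ 2)\<^sup>2)))"
  have e: "s * s = 1 - c * c" "s' * s' = 1 - c' * c'"
    by (simp_all add: d sin_squared_eq flip: power2_eq_square)
  \<comment> \<open>These forms catch squares inside longer, right-nested products.\<close>
  have "s * (s * y) = (1 - c * c) * y" "s' * (s' * y) = (1 - c' * c') * y" for y
    by (simp_all flip: e)
  note e = e this
  show ?thesis
    using exhaust_3[of a] exhaust_3[of b]
    unfolding rot3_def Let_def d[symmetric]
    by (elim disjE) (simp_all add: inner_vec_def sum_3 e algebra_simps)
qed

lemma rot8_orthogonal: "orthogonal_matrix (rot8 M)"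
proof -
  have "(rot8 M ** transpose (rot8 M)) $ a $ b = rot8 M $ a \<bullet> rot8 M $ b" for a b
    by (simp add: matrix_matrix_mult_def transpose_def inner_vec_def)
  moreover have "\<forall>a b. rot8 M $ a \<bullet> rot8 M $ b = mat 1 $ a $ b"
    unfolding forall_8 by (simp add: rot8_def inner_pack8 rot3_orthonormal mat_def)
  ultimately have "rot8 M ** transpose (rot8 M) = mat 1"
    by (simp add: vec_eq_iff)
  then show ?thesis
    by (simp add: orthogonal_matrix_def matrix_left_right_inverse)
qed

lemma matrix_inv_orthogonal:
  fixes Q :: "real ^ 'n ^ 'n"
  assumes "orthogonal_matrix Q"
  shows "matrix_inv Q = transpose Q"
proof -
  have "\<exists>A. Q ** A = mat 1 \<and> A ** Q = mat 1"
    using assms unfolding orthogonal_matrix_def by blast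
  then have inv: "Q ** matrix_inv Q = mat 1"
    unfolding matrix_inv_def by (rule someI2_ex) simp
  have "matrix_inv Q = (transpose Q ** Q) ** matrix_inv Q"
    using assms by (simp add: orthogonal_matrix_def)
  also have "\<dots> = transpose Q"
    by (simp add: inv flip: matrix_mul_assoc)
  finally show ?thesis .
qed

lemma inner_transpose_matrix:
  fixes A :: "real ^ 'n ^ 'm"
  shows "x \<bullet> (transpose A *v y) = (A *v x) \<bullet> y"
  by (metis dot_lmul_matrix vector_transpose_matrix)

text \<open>As \<open>T\<close> is orthogonal, the inverse of \<open>T\<close> times
  \<open>R\<close> is the transpose of the matrix defining the scaled variables.\<close>

lemma inner_dissipation:
  "entropy_vars \<Gamma> (U i) \<bullet> (dissipation R lam u mt mx *v w) =
    lambda_hat lam u mt mx * (scaled_vars \<Gamma> R u mx U i \<bullet> w)"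
  unfolding dissipation_def scaled_vars_def matrix_inv_orthogonal[OF rot8_orthogonal]
    scaleR_matrix_vector_assoc[symmetric] matrix_vector_mul_assoc[symmetric] inner_scaleR_right
    inner_transpose_matrix inner_commute[of _ w]
  by (simp add: inner_commute)

lemma lambda_hat_nonneg: "lambda_hat lam u mt mx \<ge> 0"
proof -
  let ?f = "\<lambda>m. \<bar>mt + sqrt (\<Sum>j\<in>UNIV. (mx $ j)\<^sup>2) * lam (rot8 mx *v u) $ m\<bar>"
  have "?f 1 \<le> Max (range ?f)" by (intro Max_ge) auto
  then show ?thesis unfolding lambda_hat_def by linarith
qed

lemma same_sign_mult: "(same_sign a b *v w) $ c = (if sgn (a $ c) = sgn (b $ c) then w $ c else 0)"
  by (cases "sgn (a $ c) = sgn (b $ c)")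
    (simp_all add: same_sign_def matrix_vector_mult_def mult_delta_left)

text \<open>Componentwise, either both factors have the same \<open>sgn\<close>, or the switch makes
  the second factor 0.\<close>

lemma jump_inner_limited_jump_nonneg:
  "jump (scaled_vars \<Gamma> R (Uf i k) (Mxf i k) U) i k \<bullet> limited_jump \<Gamma> \<epsilon> p R U Uf Mxf i k \<ge> 0"
  unfolding limited_jump_def Let_def inner_vec_def same_sign_mult
  by (intro sum_nonneg) (auto simp: sgn_if zero_le_mult_iff split: if_splits)

text \<open>At a vanishing jump the sign switch is off in every component in which the WENO jump does not
  vanish as well.\<close>

lemma limited_jump_eq_0:
  assumes "U (i + axis k 1) = U i"
  shows "limited_jump \<Gamma> \<epsilon> p R U Uf Mxf i k = 0"
proof -
  have "jump (scaled_vars \<Gamma> R (Uf i k) (Mxf i k) U) i k = 0"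
    by (simp add: jump_def scaled_vars_def assms)
  then show ?thesis
    unfolding limited_jump_def Let_def by (subst vec_eq_iff) (simp add: same_sign_mult sgn_0_0)
qed

text \<open>With the matrices frozen at the interface, the scaled variables at its two neighbours
  are the mean minus and plus half the jump, and the jump term has a sign.\<close>

lemma entropy_production_dissipation:
  fixes \<Gamma> \<epsilon> p R lam U Uf Mtf Mxf
  defines "\<mu> \<equiv> \<lambda>i k. lambda_hat lam (Uf i k) (Mtf i k) (Mxf i k)"
    and "L \<equiv> \<lambda>i k. limited_jump \<Gamma> \<epsilon> p R U Uf Mxf i k"
    and "S \<equiv> \<lambda>i k. scaled_vars \<Gamma> R (Uf i k) (Mxf i k) U"
    and "D \<equiv> \<lambda>i k. dissipation R lam (Uf i k) (Mtf i k) (Mxf i k)"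
  shows "entropy_vars \<Gamma> (U i) \<bullet> (D i k *v L i k) \<le> \<mu> i k * (mean (S i k) i k \<bullet> L i k)"
    and "\<mu> i k * (mean (S i k) i k \<bullet> L i k)
      \<le> entropy_vars \<Gamma> (U (i + axis k 1)) \<bullet> (D i k *v L i k)"
proof -
  have "\<mu> i k * (jump (S i k) i k \<bullet> L i k) \<ge> 0"
    unfolding \<mu>_def S_def L_def by (intro mult_nonneg_nonneg lambda_hat_nonneg jump_inner_limited_jump_nonneg)
  then show "entropy_vars \<Gamma> (U i) \<bullet> (D i k *v L i k) \<le> \<mu> i k * (mean (S i k) i k \<bullet> L i k)"
    and "\<mu> i k * (mean (S i k) i k \<bullet> L i k)
      \<le> entropy_vars \<Gamma> (U (i + axis k 1)) \<bullet> (D i k *v L i k)"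
    unfolding D_def inner_dissipation \<mu>_def S_def
    by (simp_all add: jump_def mean_def inner_diff_left inner_add_left algebra_simps)
qed

text \<open>The first two terms are the rate from \<open>weighted_eta_has_derivative\<close> with
  the right-hand sides of the scheme inserted.\<close>

lemma entropy_production_le:
  assumes tp: "two_point_fluxes \<Gamma> Ut Ft" and adm: "\<And>i. U i \<in> admissible \<Gamma>"
    and \<Delta>: "\<And>k. \<Delta> $ k > 0" and Mx: "\<And>i k. Mx i k = metric_x p \<alpha> \<Delta> x i k"
  shows "entropy_vars \<Gamma> (U i) \<bullet>
        (- flux_div \<Delta> (flux_hat \<Gamma> \<epsilon> p \<alpha> Ut Ft R lam Mt Mx U Uf Mtf Mxf) i
         - flux_div \<Delta> (high_order p \<alpha> (mag2 Mx U)) i *\<^sub>R dPhi \<Gamma> (U i))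
      - pot_phi \<Gamma> (U i) * - flux_div \<Delta> (high_order p \<alpha> (metric_t2 Mt)) i
      + flux_div \<Delta> (entropy_flux_hat \<Gamma> \<epsilon> p \<alpha> Ut Ft R lam Mt Mx U Uf Mtf Mxf) i \<le> 0"
    (is "?lhs \<le> 0")
proof -
  let ?V = "entropy_vars \<Gamma> (U i)"
  let ?F = "flux_hat \<Gamma> \<epsilon> p \<alpha> Ut Ft R lam Mt Mx U Uf Mtf Mxf"
  let ?Q = "entropy_flux_hat \<Gamma> \<epsilon> p \<alpha> Ut Ft R lam Mt Mx U Uf Mtf Mxf"
  let ?M = "high_order p \<alpha> (metric_t2 Mt)" and ?B = "high_order p \<alpha> (mag2 Mx U)"
  let ?cd = "\<lambda>j k. central_diff p \<alpha> k (\<lambda>i. Mx i k $ j) i"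
  \<comment> \<open>The first dissipation bound is used at the interface \<open>(i, k)\<close>,
    where \<open>i\<close> is the left neighbour, the second at \<open>(i - axis k 1, k)\<close>,
    where it is the right one.\<close>
  have X: "pot_phi \<Gamma> (U i) * (?M i k - ?M (i - axis k 1) k) - ?V \<bullet> (?F i k - ?F (i - axis k 1) k)
      - Phi \<Gamma> (U i) * (?B i k - ?B (i - axis k 1) k) + (?Q i k - ?Q (i - axis k 1) k)
      \<le> - (\<Sum>j\<in>UNIV. pot_psi \<Gamma> j (U i) * ?cd j k)" for k
    using high_order_balance[where \<Gamma> = \<Gamma> and U = U and i = i and k = k and p = p and \<alpha> = \<alpha>
        and Mt = Mt and Mx = Mx, OF tp adm]
      entropy_production_dissipation(1)[where \<Gamma> = \<Gamma> and \<epsilon> = \<epsilon> and p = p and R = R and lam = lam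
          and U = U and Uf = Uf and Mtf = Mtf and Mxf = Mxf and k = k and i = i]
      entropy_production_dissipation(2)[where \<Gamma> = \<Gamma> and \<epsilon> = \<epsilon> and p = p and R = R and lam = lam
          and U = U and Uf = Uf and Mtf = Mtf and Mxf = Mxf and k = k and i = "i - axis k 1"]
    unfolding flux_hat_def entropy_flux_hat_def
    by (simp add: inner_diff_right algebra_simps)
  have "?lhs = (\<Sum>k\<in>UNIV. 1 / \<Delta> $ k *
      (pot_phi \<Gamma> (U i) * (?M i k - ?M (i - axis k 1) k) - ?V \<bullet> (?F i k - ?F (i - axis k 1) k)
      - Phi \<Gamma> (U i) * (?B i k - ?B (i - axis k 1) k) + (?Q i k - ?Q (i - axis k 1) k)))"
    using entropy_vars_inner_dPhi[OF adm[of i]]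
    by (simp add: flux_div_def sum_3 inner_diff_right inner_add_right algebra_simps
        add_divide_distrib diff_divide_distrib)
  also have "\<dots> \<le> (\<Sum>k\<in>UNIV. 1 / \<Delta> $ k * - (\<Sum>j\<in>UNIV. pot_psi \<Gamma> j (U i) * ?cd j k))"
    using \<Delta> by (intro sum_mono mult_left_mono X) (simp add: less_imp_le)
  \<comment> \<open>\<open>pot_psi\<close> does not depend on \<open>k\<close>, so exchanging the
    sums exposes the conservation law \<open>metric_x_gcl\<close> for each \<open>j\<close>.\<close>
  also have "\<dots> = - (\<Sum>j\<in>UNIV. pot_psi \<Gamma> j (U i) * (\<Sum>k\<in>UNIV. 1 / \<Delta> $ k * ?cd j k))"
    by (simp add: sum_3 algebra_simps add_divide_distrib)
  also have "\<dots> = 0"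
    using metric_x_gcl[of \<Delta> p \<alpha> x] by (simp add: Mx)
  finally show ?thesis .
qed

section \<open>Consistency\<close>

text \<open>At coinciding arguments the definitions of \<open>pot_phi\<close> and
  \<open>pot_psi\<close> cancel everything except \<open>eta\<close> and the physical entropy
  fluxes.\<close>

lemma entropy_flux2_consistent:
  assumes tp: "two_point_fluxes \<Gamma> Ut Ft" and u: "u \<in> admissible \<Gamma>"
    and "U l = u" "U r = u" "Mt l k = mt" "Mt r k = mt" "Mx l k = mx" "Mx r k = mx"
  shows "entropy_flux2 \<Gamma> Ut Ft Mt Mx U k l r =
    mt * eta \<Gamma> u + (\<Sum>j\<in>UNIV. mx $ j * entropy_flux \<Gamma> j u)"
proof -
  have "Ut u u = u" "\<And>j. Ft j u u = flux \<Gamma> j u"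
    using tp u unfolding two_point_fluxes_def smooth_symmetric_consistent_def by blast+
  then show ?thesis
    unfolding entropy_flux2_def flux2_def assms(3-) sum_3 scaleR_half_double
    by (simp add: pot_phi_def pot_psi_def inner_add_left inner_add_right algebra_simps)
qed

lemma entropy_flux_hat_consistent:
  assumes "p \<ge> 1" and \<alpha>: "central_coeffs p \<alpha>" and tp: "two_point_fluxes \<Gamma> Ut Ft"
    and u: "u \<in> admissible \<Gamma>"
    and c: "\<And>n. n \<in> {1 - int p..int p} \<Longrightarrow>
      U (i + axis k n) = u \<and> Mt (i + axis k n) k = mt \<and> Mx (i + axis k n) k = mx"
  shows "entropy_flux_hat \<Gamma> \<epsilon> p \<alpha> Ut Ft R lam Mt Mx U Uf Mtf Mxf i k =
    mt * eta \<Gamma> u + (\<Sum>j\<in>UNIV. mx $ j * entropy_flux \<Gamma> j u)" (is "_ = ?q")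
proof -
  have ax: "axis k (0::int) = 0" by (simp add: vec_eq_iff axis_def)
  have "U (i + axis k 1) = U i"
    using c[of 1] c[of 0] \<open>p \<ge> 1\<close> by (simp add: ax)
  then have L: "limited_jump \<Gamma> \<epsilon> p R U Uf Mxf i k = 0"
    by (rule limited_jump_eq_0)
  \<comment> \<open>From \<open>s < n\<close> and \<open>n \<le> p\<close>, the offsets
    \<open>- s\<close> and \<open>- s + n\<close> both lie between \<open>1 - p\<close> and
    \<open>p\<close>.\<close>
  have "entropy_flux2 \<Gamma> Ut Ft Mt Mx U k (i + axis k (- int s)) (i + axis k (- int s + int n)) = ?q"
    if "n \<in> {1..p}" "s < n" for n s
    using that c[of "- int s"] c[of "- int s + int n"]
    by (intro entropy_flux2_consistent[OF tp u]) auto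
  \<comment> \<open>The inner sum has \<open>n\<close> equal terms, so the first condition in
    \<open>central_coeffs\<close> normalises the total to one copy.\<close>
  then have "high_order p \<alpha> (entropy_flux2 \<Gamma> Ut Ft Mt Mx U) i k = (\<Sum>n=1..p. \<alpha> n * (real n * ?q))"
    unfolding high_order_def by (intro sum.cong) auto
  also have "\<dots> = (\<Sum>n=1..p. real n * \<alpha> n) * ?q"
    by (simp add: sum_distrib_right mult_ac)
  also have "\<dots> = ?q"
    using \<alpha> by (simp add: central_coeffs_def)
  finally show ?thesis
    by (simp add: entropy_flux_hat_def L)
qed

section \<open>Entropy stability of the scheme and consistency of its entropy fluxes\<close>

theorem theorem4p1:
  fixes \<Gamma> \<epsilon> :: real and p :: nat and \<alpha> :: "nat \<Rightarrow> real" and \<Delta> :: vec3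
    and Ut :: "vec8 \<Rightarrow> vec8 \<Rightarrow> vec8" and Ft :: "3 \<Rightarrow> vec8 \<Rightarrow> vec8 \<Rightarrow> vec8"
    and R :: "vec8 \<Rightarrow> real ^ 8 ^ 8" and lam :: "vec8 \<Rightarrow> vec8"
    and I :: "real set"
    and x xdot :: "real \<Rightarrow> grid \<Rightarrow> vec3"
    and J :: "real \<Rightarrow> grid \<Rightarrow> real" and U :: "real \<Rightarrow> grid \<Rightarrow> vec8"
    and Uf :: "real \<Rightarrow> grid \<Rightarrow> 3 \<Rightarrow> vec8"
    and Mtf :: "real \<Rightarrow> grid \<Rightarrow> 3 \<Rightarrow> real" and Mxf :: "real \<Rightarrow> grid \<Rightarrow> 3 \<Rightarrow> vec3"
    and Mt :: "real \<Rightarrow> grid \<Rightarrow> 3 \<Rightarrow> real" and Mx :: "real \<Rightarrow> grid \<Rightarrow> 3 \<Rightarrow> vec3"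
  assumes "1 < \<Gamma>" and "\<Gamma> \<le> 2" and "p \<ge> 2" and "\<epsilon> > 0" and "\<And>k. \<Delta> $ k > 0"
    and "central_coeffs p \<alpha>"
    and "two_point_fluxes \<Gamma> Ut Ft"
    and "scaled_eigenvectors \<Gamma> R lam"
    and "is_interval I" and "interior I \<noteq> {}"
    and "\<And>t i. t \<in> I \<Longrightarrow> ((\<lambda>t. x t i) has_vector_derivative xdot t i) (at t within I)"
    and "\<And>t i k. Mx t i k = metric_x p \<alpha> \<Delta> (x t) i k"
    and "\<And>t i k. Mt t i k = metric_t p \<alpha> \<Delta> (x t) (xdot t) i k"
    and "\<And>t i. t \<in> I \<Longrightarrow> J t i > 0"
    and "\<And>t i. t \<in> I \<Longrightarrow> U t i \<in> admissible \<Gamma>"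
    and "\<And>t i k. t \<in> I \<Longrightarrow> Uf t i k \<in> admissible \<Gamma>"
    and "\<And>t i. t \<in> I \<Longrightarrow>
      ((\<lambda>t. J t i *\<^sub>R U t i) has_vector_derivative
        - flux_div \<Delta>
            (flux_hat \<Gamma> \<epsilon> p \<alpha> Ut Ft R lam (Mt t) (Mx t) (U t) (Uf t) (Mtf t) (Mxf t)) i
        - flux_div \<Delta> (high_order p \<alpha> (mag2 (Mx t) (U t))) i *\<^sub>R dPhi \<Gamma> (U t i))
      (at t within I)"
    and "\<And>t i. t \<in> I \<Longrightarrow>
      ((\<lambda>t. J t i) has_real_derivative
        - flux_div \<Delta> (high_order p \<alpha> (metric_t2 (Mt t))) i)
      (at t within I)"
  shows "(\<forall>t\<in>I. \<forall>i. \<exists>d.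
            ((\<lambda>t. J t i * eta \<Gamma> (U t i)) has_real_derivative d) (at t within I) \<and>
            d + flux_div \<Delta>
                  (entropy_flux_hat \<Gamma> \<epsilon> p \<alpha> Ut Ft R lam
                     (Mt t) (Mx t) (U t) (Uf t) (Mtf t) (Mxf t)) i \<le> 0) \<and>
         (\<forall>M\<^sub>t M\<^sub>x V V\<^sub>f M\<^sub>t\<^sub>f M\<^sub>x\<^sub>f i k. \<forall>u\<in>admissible \<Gamma>. \<forall>(mt :: real) (mx :: vec3).
            (\<forall>n\<in>{1 - int p..int p}. V (i + axis k n) = u \<and>
               M\<^sub>t (i + axis k n) k = mt \<and> M\<^sub>x (i + axis k n) k = mx) \<and>
            V\<^sub>f i k = u \<and> M\<^sub>t\<^sub>f i k = mt \<and> M\<^sub>x\<^sub>f i k = mx \<longrightarrow>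
            entropy_flux_hat \<Gamma> \<epsilon> p \<alpha> Ut Ft R lam M\<^sub>t M\<^sub>x V V\<^sub>f M\<^sub>t\<^sub>f M\<^sub>x\<^sub>f i k
              = mt * eta \<Gamma> u + (\<Sum>j\<in>UNIV. mx $ j * entropy_flux \<Gamma> j u))"
proof (intro conjI ballI allI impI)
  fix t i assume t: "t \<in> I"
  \<comment> \<open>The witness \<open>d\<close> is the rate obtained by contracting the scheme with
    the entropy variables.\<close>
  from weighted_eta_has_derivative[OF assms(7) t, of "\<lambda>t. J t i" "\<lambda>t. U t i",
      OF assms(14,15) assms(17,18)[OF t]]
    entropy_production_le[of \<Gamma> Ut Ft "U t" \<Delta> "Mx t" p \<alpha> "x t", OF assms(7) assms(15)[OF t] assms(5,12)]
  show "\<exists>d. ((\<lambda>t. J t i * eta \<Gamma> (U t i)) has_real_derivative d) (at t within I) \<and>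
      d + flux_div \<Delta>
            (entropy_flux_hat \<Gamma> \<epsilon> p \<alpha> Ut Ft R lam
               (Mt t) (Mx t) (U t) (Uf t) (Mtf t) (Mxf t)) i \<le> 0"
    by blast
next
  fix M\<^sub>t :: "grid \<Rightarrow> 3 \<Rightarrow> real" and M\<^sub>x :: "grid \<Rightarrow> 3 \<Rightarrow> vec3" and V V\<^sub>f M\<^sub>t\<^sub>f M\<^sub>x\<^sub>f i k u mt mx
  assume u: "u \<in> admissible \<Gamma>"
    and c: "(\<forall>n\<in>{1 - int p..int p}. V (i + axis k n) = u \<and>
        M\<^sub>t (i + axis k n) k = mt \<and> M\<^sub>x (i + axis k n) k = mx) \<and>
      V\<^sub>f i k = u \<and> M\<^sub>t\<^sub>f i k = mt \<and> M\<^sub>x\<^sub>f i k = mx"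
  show "entropy_flux_hat \<Gamma> \<epsilon> p \<alpha> Ut Ft R lam M\<^sub>t M\<^sub>x V V\<^sub>f M\<^sub>t\<^sub>f M\<^sub>x\<^sub>f i k
      = mt * eta \<Gamma> u + (\<Sum>j\<in>UNIV. mx $ j * entropy_flux \<Gamma> j u)"
    using assms(3) c by (intro entropy_flux_hat_consistent[OF _ assms(6,7) u])
      (use assms(3) in linarith, blast)
qed

end
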